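(* Let $\delta>0$, $p\in\mathbb{R}$, $n\ge3$, and for $j=1,\dots,n-1$ let $\lambda_{0,j}\le\lambda_{1,j}$ be real such that $\varphi_j:=\Phi_{(\lambda_{0,j},\lambda_{1,j})}$ is increasing on $[-\delta,\delta]$. Assume $$c(\delta):=\sup_{0<|h|\le\delta}\max_{1\le j\le n-1}\left|T^{(p)}_{(\lambda_{0,j},\lambda_{1,j})}(h)\right|<1.$$ Then for every partition $t_1<\dots<t_n$ with $t_{j+1}-t_j\le\delta$, the matrix $(s_{i,j})$ with $s_{i,j}=\langle H_i,H_j\rangle_p$ is row diagonally dominant (with factor $c(\delta)$), and $$\|P^{\mathcal{H}_n}\|_{op}\le\max_{t\in[t_1,t_n]}\sum_{j=1}^n|H_j(t)|\cdot\frac{\sup_{0<|h|\le\delta}\max_{1\le j\le n-1}\left|S^{(p)}_{(\lambda_{0,j},\lambda_{1,j})}(h)\right|}{1-c(\delta)}.$$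
   Context: For real $\lambda_0,\dots,\lambda_N$, the fundamental function $\Phi_{(\lambda_0,\dots,\lambda_N)}$ is the unique solution $u$ of $\prod_{j=0}^N(\frac{d}{dt}-\lambda_j)u=0$ with $u^{(k)}(0)=0$ for $0\le k\le N-1$ and $u^{(N)}(0)=1$. $T^{(p)}_{(\lambda_0,\lambda_1)}(h)=\frac12\frac{\Phi_{(\lambda_0,\lambda_1,-p-\lambda_0,-p-\lambda_1)}(h)}{\Phi_{(\lambda_0-\lambda_1,\lambda_1-\lambda_0,0,-p-\lambda_0-\lambda_1)}(h)}$ and $S^{(p)}_{(\lambda_0,\lambda_1)}(h)=\frac12\frac{\Phi_{(-\lambda_0,-\lambda_1)}(h)\Phi_{(\lambda_0,\lambda_1,-p)}(h)}{\Phi_{(\lambda_0-\lambda_1,\lambda_1-\lambda_0,0,-p-\lambda_0-\lambda_1)}(h)}$ for $h\ne0$. $H_1,\dots,H_n$ are the generalized hat functions: for $2\le j\le n-1$, $H_j(t)=\frac{\varphi_{j-1}(t-t_{j-1})}{\varphi_{j-1}(t_j-t_{j-1})}$ on $[t_{j-1},t_j]$, $H_j(t)=\frac{\varphi_j(t-t_{j+1})}{\varphi_j(t_j-t_{j+1})}$ on $[t_j,t_{j+1}]$, $0$ elsewhere; $H_1=\frac{\varphi_1(t-t_2)}{\varphi_1(t_1-t_2)}$ on $[t_1,t_2]$, $0$ elsewhere; $H_n=\frac{\varphi_{n-1}(t-t_{n-1})}{\varphi_{n-1}(t_n-t_{n-1})}$ on $[t_{n-1},t_n]$, $0$ elsewhere.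 $\mathcal{H}_n=\mathrm{span}\{H_1,\dots,H_n\}$ (the piecewise exponential splines of order 2 with frequencies $(\lambda_{0,j},\lambda_{1,j})$ on $[t_j,t_{j+1}]$). $\langle f,g\rangle_p=\int_{t_1}^{t_n}f(t)g(t)e^{pt}dt$; $P^{\mathcal{H}_n}$ is the $\langle\cdot,\cdot\rangle_p$-orthogonal projection of $C[t_1,t_n]$ onto $\mathcal{H}_n$, $\|P^{\mathcal{H}_n}\|_{op}=\sup_{f\ne0}\|P^{\mathcal{H}_n}f\|_\infty/\|f\|_\infty$. Row diagonally dominant with factor $c$: $|s_{j-1,j}|+|s_{j,j+1}|\le c|s_{j,j}|$ for all $j$, with $s_{0,1}=s_{n,n+1}=0$. *)

theory Defs
  imports "HOL-Analysis.Analysis"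
begin

fun diffop :: "real list \<Rightarrow> (real \<Rightarrow> real) \<Rightarrow> (real \<Rightarrow> real)" where
  "diffop [] u = u"
| "diffop (l # ls) u = (\<lambda>t. deriv (diffop ls u) t - l * diffop ls u t)"

definition Phi :: "real list \<Rightarrow> real \<Rightarrow> real" where
  "Phi ls = (THE u. (\<forall>k t. (deriv ^^ k) u differentiable (at t))
                   \<and> (\<forall>t. diffop ls u t = 0)
                   \<and> (\<forall>k < length ls - 1. (deriv ^^ k) u 0 = 0)
                   \<and> (deriv ^^ (length ls - 1)) u 0 = 1)"

definition Tfun :: "real \<Rightarrow> real \<Rightarrow> real \<Rightarrow> real \<Rightarrow> real" where
  "Tfun p l0 l1 h = (1/2) * Phi [l0, l1, -p-l0, -p-l1] h
                      / Phi [l0-l1, l1-l0, 0, -p-l0-l1] h"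

definition Sfun :: "real \<Rightarrow> real \<Rightarrow> real \<Rightarrow> real \<Rightarrow> real" where
  "Sfun p l0 l1 h = (1/2) * Phi [-l0, -l1] h * Phi [l0, l1, -p] h
                      / Phi [l0-l1, l1-l0, 0, -p-l0-l1] h"

definition hat :: "(nat \<Rightarrow> real) \<Rightarrow> (nat \<Rightarrow> real \<Rightarrow> real) \<Rightarrow> nat \<Rightarrow> nat \<Rightarrow> real \<Rightarrow> real" where
  "hat t phi n j x =
     (if 2 \<le> j \<and> t (j-1) \<le> x \<and> x \<le> t j
      then phi (j-1) (x - t (j-1)) / phi (j-1) (t j - t (j-1))
      else if j \<le> n - 1 \<and> t j \<le> x \<and> x \<le> t (j+1)
      then phi j (x - t (j+1)) / phi j (t j - t (j+1))
      else 0)"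

definition ipp :: "real \<Rightarrow> real \<Rightarrow> real \<Rightarrow> (real \<Rightarrow> real) \<Rightarrow> (real \<Rightarrow> real) \<Rightarrow> real" where
  "ipp p a b f g = integral {a..b} (\<lambda>x. f x * g x * exp (p * x))"

definition Hspace :: "(nat \<Rightarrow> real) \<Rightarrow> (nat \<Rightarrow> real \<Rightarrow> real) \<Rightarrow> nat \<Rightarrow> (real \<Rightarrow> real) set" where
  "Hspace t phi n = {(\<lambda>x. \<Sum>j=1..n. c j * hat t phi n j x) | c. True}"

definition projH :: "real \<Rightarrow> (nat \<Rightarrow> real) \<Rightarrow> (nat \<Rightarrow> real \<Rightarrow> real) \<Rightarrow> nat
                      \<Rightarrow> (real \<Rightarrow> real) \<Rightarrow> (real \<Rightarrow> real)" where
  "projH p t phi n f = (THE g. g \<in> Hspace t phi n \<and>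
      (\<forall>h \<in> Hspace t phi n. ipp p (t 1) (t n) (\<lambda>x. f x - g x) h = 0))"

definition supn :: "real \<Rightarrow> real \<Rightarrow> (real \<Rightarrow> real) \<Rightarrow> real" where
  "supn a b f = (SUP x\<in>{a..b}. \<bar>f x\<bar>)"

definition opratios :: "real \<Rightarrow> (nat \<Rightarrow> real) \<Rightarrow> (nat \<Rightarrow> real \<Rightarrow> real) \<Rightarrow> nat \<Rightarrow> real set" where
  "opratios p t phi n =
     {supn (t 1) (t n) (projH p t phi n f) / supn (t 1) (t n) f | f.
        continuous_on {t 1..t n} f \<and> (\<exists>x\<in>{t 1..t n}. f x \<noteq> 0)}"

definition opnormH :: "real \<Rightarrow> (nat \<Rightarrow> real) \<Rightarrow> (nat \<Rightarrow> real \<Rightarrow> real) \<Rightarrow> nat \<Rightarrow> real" where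
  "opnormH p t phi n = Sup (opratios p t phi n)"

text \<open>Gram matrix entries, with s_{i,j} = 0 outside 1..n (so s_{0,1} = s_{n,n+1} = 0).\<close>
definition gram :: "real \<Rightarrow> (nat \<Rightarrow> real) \<Rightarrow> (nat \<Rightarrow> real \<Rightarrow> real) \<Rightarrow> nat \<Rightarrow> nat \<Rightarrow> nat \<Rightarrow> real" where
  "gram p t phi n i j =
     (if i \<in> {1..n} \<and> j \<in> {1..n}
      then ipp p (t 1) (t n) (hat t phi n i) (hat t phi n j) else 0)"

definition row_diag_dom :: "nat \<Rightarrow> (nat \<Rightarrow> nat \<Rightarrow> real) \<Rightarrow> real \<Rightarrow> bool" where
  "row_diag_dom n s c =
     (\<forall>j\<in>{1..n}. \<bar>s (j-1) j\<bar> + \<bar>s j (j+1)\<bar> \<le> c * \<bar>s j j\<bar>)"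

end

(* On an edge of length h both hat functions are translates of phi = Phi [l0, l1]. The weighted
   integrals of phi(s)^2, phi(s) and phi(s) phi(s - h) are, up to exponential factors, the fundamental
   functions occurring in T and S, evaluated at h; the roles of the two hats are exchanged by
   replacing h by -h. Hence on each edge the mixed integral is at most c times either pure one, and the
   integral of a hat is at most sup |S| times that of its square. Adding the two edges at a node gives
   row dominance of the Gram matrix; evaluating the normal equations of the projection at a coefficient
   of maximal modulus then bounds all coefficients. *)

theory Submission
  imports Defs
begin

section \<open>Fundamental functions\<close>

text \<open>Frequencies may coincide (already \<open>l0 = l1\<close> is allowed), so closed formulas
  with differences of frequencies in the denominator would split into many cases. Everything rests
  instead on one recursion: \<open>Phi (ls @ [m])\<close> is the solution of u' = m u +
  \<open>Phi ls\<close> that vanishes at 0. An identity between fundamental functions is proved by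
  checking that both sides solve the same first-order initial value problem, and a weighted integral
  is evaluated by exhibiting an antiderivative built from longer fundamental functions. The
  denominator of \<open>Tfun\<close> and \<open>Sfun\<close> is not assumed to be nonzero: it is a
  nonzero multiple of the weighted integral of a squared hat, which is positive. The projection is
  obtained without inverting a matrix: existence comes from Gram-Schmidt, uniqueness from the same
  diagonal dominance that gives the norm bound.\<close>

definition smooth :: "(real \<Rightarrow> real) \<Rightarrow> bool" where
  "smooth u \<longleftrightarrow> (\<forall>k t. (deriv ^^ k) u differentiable (at t))"

definition fundamental :: "real list \<Rightarrow> (real \<Rightarrow> real) \<Rightarrow> bool" where
  "fundamental ls u \<longleftrightarrow> smooth u \<and> (\<forall>t. diffop ls u t = 0)
     \<and> (\<forall>k < length ls - 1. (deriv ^^ k) u 0 = 0) \<and> (deriv ^^ (length ls - 1)) u 0 = 1"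

lemma Phi_eq_The_fundamental: "Phi ls = (THE u. fundamental ls u)"
  unfolding Phi_def fundamental_def smooth_def by (simp add: conj_assoc)

lemma smooth_has_deriv:
  assumes "smooth u"
  shows "((deriv ^^ k) u has_real_derivative (deriv ^^ Suc k) u t) (at t)"
  using assms unfolding smooth_def by (simp add: DERIV_deriv_iff_real_differentiable)

lemma deriv_iterate_diff:
  assumes u: "smooth u"
  shows "(deriv ^^ k) (\<lambda>t. deriv u t - m * u t)
           = (\<lambda>t. (deriv ^^ Suc k) u t - m * (deriv ^^ k) u t)"
proof (induction k)
  case (Suc k)
  have "((\<lambda>t. (deriv ^^ Suc k) u t - m * (deriv ^^ k) u t) has_real_derivative
          (deriv ^^ Suc (Suc k)) u t - m * (deriv ^^ Suc k) u t) (at t)" for t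
    by (intro DERIV_diff DERIV_cmult smooth_has_deriv u)
  then show ?case using Suc.IH by (auto dest: DERIV_imp_deriv)
qed simp

lemma smooth_deriv_diff:
  assumes u: "smooth u"
  shows "smooth (\<lambda>t. deriv u t - m * u t)"
  unfolding smooth_def deriv_iterate_diff[OF u]
  using u[unfolded smooth_def, rule_format, of "Suc _"] u[unfolded smooth_def]
  by (intro allI differentiable_diff differentiable_mult) auto

text \<open>Bootstrapping: the equation expresses each derivative of \<open>u\<close> through the
  previous one and a derivative of \<open>v\<close>. The induction carries this formula along with
  differentiability, since it is what makes the next derivative exist.\<close>

lemma smooth_first_order:
  assumes v: "smooth v" and u: "\<And>t. (u has_real_derivative m * u t + v t) (at t)"
  shows "smooth u"
proof -
  have "(\<forall>t. (deriv ^^ k) u differentiable (at t)) \<and>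
        (deriv ^^ Suc k) u = (\<lambda>t. m * (deriv ^^ k) u t + (deriv ^^ k) v t)" for k
  proof (induction k)
    case 0
    show ?case using u by (auto simp: real_differentiable_def dest: DERIV_imp_deriv)
  next
    case (Suc k)
    have D: "((deriv ^^ Suc k) u has_real_derivative
               m * (deriv ^^ Suc k) u t + (deriv ^^ Suc k) v t) (at t)" for t
    proof -
      have "((deriv ^^ k) u has_real_derivative (deriv ^^ Suc k) u t) (at t)"
      proof -
        have "(deriv ^^ k) u differentiable (at t)" using Suc.IH by blast
        then show ?thesis by (simp add: DERIV_deriv_iff_real_differentiable)
      qed
      then have "((\<lambda>t. m * (deriv ^^ k) u t + (deriv ^^ k) v t) has_real_derivative
               m * (deriv ^^ Suc k) u t + (deriv ^^ Suc k) v t) (at t)"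
        by (intro DERIV_add DERIV_cmult smooth_has_deriv[OF v])
      then show ?thesis by (simp only: Suc.IH)
    qed
    have "(deriv ^^ Suc (Suc k)) u = deriv ((deriv ^^ Suc k) u)" by simp
    also have "\<dots> = (\<lambda>t. m * (deriv ^^ Suc k) u t + (deriv ^^ Suc k) v t)"
      using D by (blast intro: DERIV_imp_deriv)
    finally show ?case using D by (auto simp: real_differentiable_def)
  qed
  then show ?thesis by (simp add: smooth_def)
qed

text \<open>The last entry of the list is the innermost factor, so appending a frequency means
  applying d/dt - m before all the others. This is why lists grow at the end in what
  follows.\<close>

lemma diffop_snoc: "diffop (ls @ [m]) u = diffop ls (\<lambda>t. deriv u t - m * u t)"
  by (induction ls) auto

text \<open>With \<open>u 0 = 0\<close>, the vanishing of successive derivatives of u' - m u at 0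
  propagates to those of \<open>u\<close>. The list \<open>ls\<close> must be nonempty because a
  single frequency is normalised by \<open>u 0 = 1\<close>.\<close>

lemma fundamental_snoc:
  assumes "ls \<noteq> []" and u: "smooth u"
  shows "fundamental (ls @ [m]) u \<longleftrightarrow> u 0 = 0 \<and> fundamental ls (\<lambda>t. deriv u t - m * u t)"
proof -
  obtain N where N: "length ls = Suc N" using assms(1) by (cases ls) auto
  have "((\<forall>k<Suc N. (deriv ^^ k) u 0 = 0) \<and> (deriv ^^ Suc N) u 0 = 1) \<longleftrightarrow>
        u 0 = 0 \<and> (\<forall>k<N. (deriv ^^ Suc k) u 0 - m * (deriv ^^ k) u 0 = 0) \<and>
         (deriv ^^ Suc N) u 0 - m * (deriv ^^ N) u 0 = 1" (is "?L \<longleftrightarrow> ?R")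
  proof
    assume L: ?L
    then have "(deriv ^^ k) u 0 = 0" if "k < Suc N" for k using that by blast
    from this[of 0] this[of N] this L show ?R by (auto simp del: funpow.simps(2))
  next
    assume R: ?R
    have "(deriv ^^ k) u 0 = 0" if "k < Suc N" for k using that
      by (induction k) (use R in auto)
    with R show ?L by simp
  qed
  then show ?thesis
    unfolding fundamental_def deriv_iterate_diff[OF u] diffop_snoc
    using N u smooth_deriv_diff[OF u] by auto
qed

text \<open>The integrating factor makes \<open>exp (- m * t) * (u t - w t)\<close> constant. This
  is the device by which identities between fundamental functions are proved below.\<close>

lemma first_order_unique:
  fixes u w v :: "real \<Rightarrow> real"
  assumes u: "\<And>t. (u has_real_derivative m * u t + v t) (at t)"
    and w: "\<And>t. (w has_real_derivative m * w t + v t) (at t)"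
    and "u 0 = w 0"
  shows "u = w"
proof
  fix t
  have "((\<lambda>t. exp (- m * t) * (u t - w t)) has_real_derivative 0) (at t)" for t
    by (rule derivative_eq_intros u w refl | simp add: algebra_simps)+
  then have "exp (- m * t) * (u t - w t) = exp (- m * 0) * (u 0 - w 0)"
    by (rule DERIV_isconst_all[rule_format])
  with assms(3) show "u t = w t" by simp
qed

text \<open>Variation of constants, with an antiderivative \<open>F\<close> of
  \<open>exp (- m * s) * v s\<close> taken on the whole line so that both sides of 0 are served at
  once.\<close>

lemma first_order_solution:
  assumes v: "continuous_on UNIV v"
  obtains u :: "real \<Rightarrow> real" where "u 0 = 0" "\<And>t. (u has_real_derivative m * u t + v t) (at t)"
proof -
  have "isCont (\<lambda>s. exp (- m * s) * v s) x" for x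
    using v by (intro continuous_intros) (auto simp: continuous_on_eq_continuous_at)
  then obtain F where F: "\<And>x. (F has_real_derivative exp (- m * x) * v x) (at x)"
    using einterval_antiderivative[of "-\<infinity>" "\<infinity>" "\<lambda>s. exp (- m * s) * v s"]
    by (auto simp: has_real_derivative_iff_has_vector_derivative)
  show ?thesis
  proof (rule that[of "\<lambda>t. exp (m * t) * (F t - F 0)"])
    fix t
    have e: "exp (m * t) * exp (- m * t) = 1" by (simp flip: exp_add)
    show "((\<lambda>t. exp (m * t) * (F t - F 0)) has_real_derivative
            m * (exp (m * t) * (F t - F 0)) + v t) (at t)"
      by (rule derivative_eq_intros F refl | simp)+ (use e in \<open>simp add: algebra_simps\<close>)
  qed simp
qed

lemma fundamental_singleton: "fundamental [l] (\<lambda>t. exp (l * t))"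
proof -
  have D: "((\<lambda>t. exp (l * t)) has_real_derivative l * exp (l * t) + 0) (at t)" for t
    by (auto intro!: derivative_eq_intros)
  have "smooth (\<lambda>t. 0)"
  proof -
    have "(deriv ^^ k) (\<lambda>t. 0 :: real) = (\<lambda>t. 0)" for k by (induction k) auto
    then show ?thesis by (simp add: smooth_def)
  qed
  then have "smooth (\<lambda>t. exp (l * t))" using D by (rule smooth_first_order)
  then show ?thesis using DERIV_imp_deriv[OF D] by (simp add: fundamental_def)
qed

lemma fundamental_singleton_unique:
  assumes "fundamental [l] u"
  shows "u = (\<lambda>t. exp (l * t))"
proof (rule first_order_unique[where m = l and v = "\<lambda>t. 0"])
  fix t
  show "(u has_real_derivative l * u t + 0) (at t)"
    using assms smooth_has_deriv[of u 0 t] by (simp add: fundamental_def)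
qed (use assms in \<open>auto intro!: derivative_eq_intros simp: fundamental_def\<close>)

lemma smooth_has_deriv_1: "smooth u \<Longrightarrow> (u has_real_derivative deriv u t) (at t)"
  using smooth_has_deriv[of u 0 t] by simp

text \<open>\<open>Phi\<close> is a definite description, so nothing can be said about it before
  this. Reverse induction splits off the innermost factor, leaving a first-order equation driven by
  the shorter fundamental function.\<close>

lemma ex1_fundamental:
  assumes "ls \<noteq> []"
  shows "\<exists>!u. fundamental ls u"
  using assms
proof (induction ls rule: rev_induct)
  case (snoc m ls)
  show ?case
  proof (cases "ls = []")
    case True
    then show ?thesis using fundamental_singleton fundamental_singleton_unique by (metis append_Nil)
  next
    case False
    then obtain v where v: "fundamental ls v" and uniq: "\<And>w. fundamental ls w \<Longrightarrow> w = v"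
      using snoc.IH by auto
    have sv: "smooth v" using v by (simp add: fundamental_def)
    then have "continuous_on UNIV v"
      by (meson DERIV_continuous_on has_field_derivative_at_within smooth_has_deriv_1)
    then obtain u where u0: "u 0 = 0" and u: "\<And>t. (u has_real_derivative m * u t + v t) (at t)"
      using first_order_solution by blast
    have "smooth u" using smooth_first_order[OF sv u] .
    moreover have "(\<lambda>t. deriv u t - m * u t) = v" using DERIV_imp_deriv[OF u] by auto
    ultimately have ex: "fundamental (ls @ [m]) u"
      using fundamental_snoc[OF False] u0 v by simp
    have "w = u" if w: "fundamental (ls @ [m]) w" for w
    proof (rule first_order_unique[where m = m and v = v])
      have sw: "smooth w" using w by (simp add: fundamental_def)
      then have w': "w 0 = 0" "(\<lambda>t. deriv w t - m * w t) = v"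
        using fundamental_snoc[OF False sw] w uniq by auto
      show "(w has_real_derivative m * w t + v t) (at t)" for t
        using smooth_has_deriv_1[OF sw, of t] fun_cong[OF w'(2), of t] by (simp add: algebra_simps)
      show "w 0 = u 0" using w' u0 by simp
    qed (fact u)
    with ex show ?thesis by blast
  qed
qed simp

lemma fundamental_Phi: "ls \<noteq> [] \<Longrightarrow> fundamental ls (Phi ls)"
  unfolding Phi_eq_The_fundamental using theI'[OF ex1_fundamental] .

lemma Phi_singleton: "Phi [l] = (\<lambda>t. exp (l * t))"
  using fundamental_singleton_unique fundamental_Phi by blast

text \<open>Together with \<open>Phi_singleton\<close>, this recursion is all that the rest of the
  development uses about \<open>Phi\<close>.\<close>

lemma
  assumes "ls \<noteq> []"
  shows Phi_snoc_0: "Phi (ls @ [m]) 0 = 0"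
    and Phi_snoc_deriv: "(Phi (ls @ [m]) has_real_derivative m * Phi (ls @ [m]) t + Phi ls t) (at t)"
proof -
  have s: "smooth (Phi (ls @ [m]))"
    using fundamental_Phi[of "ls @ [m]"] by (simp add: fundamental_def)
  have F: "Phi (ls @ [m]) 0 = 0" "fundamental ls (\<lambda>t. deriv (Phi (ls @ [m])) t - m * Phi (ls @ [m]) t)"
    using fundamental_Phi[of "ls @ [m]"] fundamental_snoc[OF assms s] by auto
  show "Phi (ls @ [m]) 0 = 0" by fact
  have "(\<lambda>t. deriv (Phi (ls @ [m])) t - m * Phi (ls @ [m]) t) = Phi ls"
    using F(2) fundamental_Phi[OF assms] ex1_fundamental[OF assms] by blast
  from fun_cong[OF this, of t] smooth_has_deriv_1[OF s, of t]
  show "(Phi (ls @ [m]) has_real_derivative m * Phi (ls @ [m]) t + Phi ls t) (at t)"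
    by (simp add: algebra_simps)
qed

lemma Phi_snoc_eqI:
  assumes "ls \<noteq> []" "u 0 = 0" "\<And>t. (u has_real_derivative m * u t + Phi ls t) (at t)"
  shows "Phi (ls @ [m]) = u"
  by (rule first_order_unique[where m = m and v = "Phi ls"])
     (use assms Phi_snoc_0 Phi_snoc_deriv in auto)

section \<open>Fundamental functions of order two and the square identity\<close>

lemma Phi2_0 [simp]: "Phi [a, b] 0 = 0"
  using Phi_snoc_0[of "[a]" b] by simp

lemma Phi2_deriv: "(Phi [a, b] has_real_derivative b * Phi [a, b] t + exp (a * t)) (at t)"
  using Phi_snoc_deriv[of "[a]" b t] by (simp add: Phi_singleton)

lemma Phi2_eqI:
  assumes "u 0 = 0" "\<And>t. (u has_real_derivative b * u t + exp (a * t)) (at t)"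
  shows "Phi [a, b] = u"
  using Phi_snoc_eqI[of "[a]" u b] assms by (simp add: Phi_singleton)

text \<open>The divided difference of exponentials with its denominator cleared, so that it holds
  for \<open>a = b\<close> as well.\<close>

lemma Phi2_diff: "(b - a) * Phi [a, b] t = exp (b * t) - exp (a * t)"
proof -
  have "(\<lambda>t. (b - a) * Phi [a, b] t + exp (a * t)) = (\<lambda>t. exp (b * t))"
    by (rule first_order_unique[where m = b and v = "\<lambda>t. 0"])
       (auto intro!: derivative_eq_intros Phi2_deriv simp: algebra_simps)
  from fun_cong[OF this, of t] show ?thesis by simp
qed

text \<open>\<open>Phi [a, b]\<close> is symmetric in its frequencies; here the other one is split
  off. The two forms of the derivative differ exactly by \<open>Phi2_diff\<close>.\<close>

lemma Phi2_deriv': "(Phi [a, b] has_real_derivative a * Phi [a, b] t + exp (b * t)) (at t)"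
  using Phi2_deriv[of a b t] Phi2_diff[of b a t] by (simp add: algebra_simps)

lemma Phi2_uminus_arg: "Phi [a, b] (- t) = - exp (- ((a + b) * t)) * Phi [a, b] t"
proof -
  have "(\<lambda>t. Phi [a, b] (- t)) = (\<lambda>t. - exp (- ((a + b) * t)) * Phi [a, b] t)"
  proof (rule first_order_unique[where m = "- b" and v = "\<lambda>t. - exp (- a * t)"])
    fix t
    show "((\<lambda>t. Phi [a, b] (- t)) has_real_derivative
            - b * Phi [a, b] (- t) + - exp (- a * t)) (at t)"
      using Phi2_deriv[of a b "- t"] by (simp add: DERIV_mirror algebra_simps)
    have "exp (- ((a + b) * t)) * exp (b * t) = exp (- a * t)"
      by (simp add: algebra_simps flip: exp_add)
    then show "((\<lambda>t. - exp (- ((a + b) * t)) * Phi [a, b] t) has_real_derivative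
            - b * (- exp (- ((a + b) * t)) * Phi [a, b] t) + - exp (- a * t)) (at t)"
      by (auto intro!: derivative_eq_intros Phi2_deriv' simp: algebra_simps)
  qed simp
  then show ?thesis by (rule fun_cong)
qed

text \<open>The source of the factor \<open>Phi [- l0, - l1] h\<close> in \<open>Sfun\<close>: it is
  the normalisation \<open>Phi [l0, l1] h\<close> of a hat times the exponential left over from the
  integral of its square.\<close>

lemma Phi2_uminus: "Phi [- a, - b] t = exp (- ((a + b) * t)) * Phi [a, b] t"
proof -
  have "Phi [- a, - b] = (\<lambda>t. exp (- ((a + b) * t)) * Phi [a, b] t)"
  proof (rule Phi2_eqI)
    fix t
    have "exp (- ((a + b) * t)) * exp (b * t) = exp (- a * t)"
      by (simp add: algebra_simps flip: exp_add)
    then show "((\<lambda>t. exp (- ((a + b) * t)) * Phi [a, b] t) has_real_derivative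
            - b * (exp (- ((a + b) * t)) * Phi [a, b] t) + exp (- a * t)) (at t)"
      by (auto intro!: derivative_eq_intros Phi2_deriv' simp: algebra_simps)
  qed simp
  then show ?thesis by (rule fun_cong)
qed

text \<open>Here \<open>E, F, E', F'\<close> stand for \<open>exp (a * t)\<close>, \<open>exp (b * t)\<close> and their inverses, and \<open>P\<close> for
  \<open>Phi [a, b] t\<close>.\<close>

lemma half_product_deriv_identity:
  fixes a b P E F E' F' :: real
  assumes "E * E' = 1" "F * F' = 1" and "b * P - a * P = F - E"
  shows "((b * P + E) * (F' + E') + (- b * F' + - a * E') * P) / 2
           = (b - a) * (P * (F' + E') / 2) + E * F'"
proof -
  have "(b * P - a * P) * E' = (F - E) * E'" "(b * P - a * P) * F' = (F - E) * F'"
    using assms(3) by simp_all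
  with assms(1,2) show ?thesis by (simp add: field_simps)
qed

lemma half_square_deriv_identity:
  fixes a b P E F E' F' :: real
  assumes "E * E' = 1" "F * F' = 1" and "b * P - a * P = F - E"
  shows "((- (a * E' * F') - b * F' * E') * P\<^sup>2 + 2 * ((b * P + E) * P) * (E' * F')) / 2
           = P * (F' + E') / 2"
proof -
  have "(- (a * E' * F') - b * F' * E') * P\<^sup>2 + 2 * ((b * P + E) * P) * (E' * F')
      = E' * F' * P * (b * P - a * P) + 2 * P * F' * (E * E')"
    by (simp add: algebra_simps power2_eq_square)
  also have "\<dots> = P * E' * (F * F') - P * F' * (E * E') + 2 * P * F' * (E * E')"
    unfolding assms(3) by (simp add: algebra_simps)
  also have "\<dots> = P * (F' + E')"
    unfolding assms(1,2) by (simp add: algebra_simps)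
  finally show ?thesis by simp
qed

text \<open>The right-hand side is half of \<open>Phi [a, b] t * Phi [- a, - b] t\<close>;
  multiplying exponents \<open>a, b\<close> by \<open>- a, - b\<close> leaves \<open>a - b\<close>,
  \<open>b - a\<close> and 0. The half normalises the second derivative at 0, and is the origin of
  the 1/2 in \<open>Tfun\<close> and \<open>Sfun\<close>.\<close>

lemma Phi3_square: "Phi [a - b, b - a, 0] t = exp (- ((a + b) * t)) * (Phi [a, b] t)\<^sup>2 / 2"
proof -
  define E F E' F' where "E t = exp (a * t)" and "F t = exp (b * t)"
    and "E' t = exp (- (a * t))" and "F' t = exp (- (b * t))" for t
  note D = E_def F_def E'_def F'_def
  have inv: "E t * E' t = 1" "F t * F' t = 1" for t
    by (simp_all add: D flip: exp_add)
  have diff: "b * Phi [a, b] t - a * Phi [a, b] t = F t - E t" for t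
    using Phi2_diff[of b a t] by (simp add: D algebra_simps)
  have der: "(E' has_real_derivative - a * E' t) (at t)"
    "(F' has_real_derivative - b * F' t) (at t)" for t
    unfolding E'_def F'_def by (auto intro!: derivative_eq_intros)
  have P: "(Phi [a, b] has_real_derivative b * Phi [a, b] t + E t) (at t)" for t
    using Phi2_deriv[of a b t] by (simp add: D)
  \<comment> \<open>The derivative of the claimed result. It equals sinh((b - a) t) / (b - a), but
    this form also makes sense for \<open>a = b\<close>.\<close>
  have P2: "Phi [a - b, b - a] = (\<lambda>t. Phi [a, b] t * (F' t + E' t) / 2)"
  proof (rule Phi2_eqI)
    fix t
    have e: "exp ((a - b) * t) = E t * F' t"
      by (simp add: D algebra_simps flip: exp_add)
    have "((\<lambda>t. Phi [a, b] t * (F' t + E' t) / 2) has_real_derivative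
       ((b * Phi [a, b] t + E t) * (F' t + E' t) + (- b * F' t + - a * E' t) * Phi [a, b] t) / 2) (at t)"
      by (intro DERIV_cdivide DERIV_mult DERIV_add P der)
    moreover have "((b * Phi [a, b] t + E t) * (F' t + E' t) + (- b * F' t + - a * E' t) * Phi [a, b] t) / 2
       = (b - a) * (Phi [a, b] t * (F' t + E' t) / 2) + exp ((a - b) * t)"
      unfolding e by (rule half_product_deriv_identity[OF inv diff])
    ultimately show "((\<lambda>t. Phi [a, b] t * (F' t + E' t) / 2) has_real_derivative
       (b - a) * (Phi [a, b] t * (F' t + E' t) / 2) + exp ((a - b) * t)) (at t)"
      by (rule DERIV_cong)
  qed simp
  have "Phi ([a - b, b - a] @ [0]) = (\<lambda>t. E' t * F' t * (Phi [a, b] t)\<^sup>2 / 2)"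
  proof (rule Phi_snoc_eqI)
    fix t
    have "((\<lambda>t. E' t * F' t * (Phi [a, b] t)\<^sup>2 / 2) has_real_derivative
       ((- a * E' t * F' t + - b * F' t * E' t) * (Phi [a, b] t)\<^sup>2
         + (of_nat 2 * ((b * Phi [a, b] t + E t) * Phi [a, b] t ^ (2 - Suc 0))) * (E' t * F' t)) / 2) (at t)"
      by (intro DERIV_cdivide DERIV_mult DERIV_power P der)
    moreover have "((- a * E' t * F' t + - b * F' t * E' t) * (Phi [a, b] t)\<^sup>2
         + (of_nat 2 * ((b * Phi [a, b] t + E t) * Phi [a, b] t ^ (2 - Suc 0))) * (E' t * F' t)) / 2
       = 0 * (E' t * F' t * (Phi [a, b] t)\<^sup>2 / 2) + Phi [a - b, b - a] t"
      unfolding P2 by (simp add: half_square_deriv_identity[OF inv diff])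
    ultimately show "((\<lambda>t. E' t * F' t * (Phi [a, b] t)\<^sup>2 / 2) has_real_derivative
       0 * (E' t * F' t * (Phi [a, b] t)\<^sup>2 / 2) + Phi [a - b, b - a] t) (at t)"
      by (rule DERIV_cong)
  qed auto
  from fun_cong[OF this, of t] show ?thesis
    by (simp add: D algebra_simps flip: exp_add)
qed

section \<open>Integrals over one edge\<close>

text \<open>The integral over an edge does not depend on the end from which it is read, whereas
  \<open>F h - F 0\<close> changes sign with \<open>h\<close>; \<open>sgn h\<close> reconciles the
  two, so one computation covers both hats of an edge.\<close>

lemma oriented_ftc:
  fixes F f :: "real \<Rightarrow> real"
  assumes "\<And>s. (F has_real_derivative f s) (at s)"
  shows "((\<lambda>x. c * f (x - r)) has_integral sgn h * (c * (F h - F 0))) {min r (r + h)..max r (r + h)}"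
proof -
  have D: "((\<lambda>x. c * F (x - r)) has_vector_derivative c * f (x - r)) (at x within A)" for x A
    unfolding has_real_derivative_iff_has_vector_derivative[symmetric]
    by (rule has_field_derivative_at_within)
       (use DERIV_cmult[OF assms[of "x + - r"], of c] DERIV_shift[of "\<lambda>x. c * F x" _ x "- r"] in simp)
  show ?thesis
  proof (cases "h \<ge> 0")
    case True
    then show ?thesis
      using fundamental_theorem_of_calculus[of r "r + h" "\<lambda>x. c * F (x - r)", OF _ D]
      by (cases "h = 0") (auto simp: algebra_simps)
  next
    case False
    then show ?thesis
      using fundamental_theorem_of_calculus[of "r + h" r "\<lambda>x. c * F (x - r)", OF _ D]
      by (auto simp: algebra_simps)
  qed
qed

text \<open>The weight shifts the frequency from \<open>m\<close> to \<open>m + p\<close>. With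
  \<open>m = - p\<close> the homogeneous term disappears, so
  \<open>exp (p * s) * Phi (ls @ [- p]) s\<close> is an antiderivative of the weighted
  \<open>Phi ls\<close>.\<close>

lemma exp_mult_first_order:
  fixes u :: "real \<Rightarrow> real"
  assumes "(u has_real_derivative m * u s + v) (at s)"
  shows "((\<lambda>s. exp (p * s) * u s) has_real_derivative
           (m + p) * (exp (p * s) * u s) + exp (p * s) * v) (at s)"
  by (rule derivative_eq_intros assms refl)+ (simp add: algebra_simps)

text \<open>Variation of constants: at \<open>s = h\<close> only the last term of the antiderivative survives, and at
  \<open>s = 0\<close> everything vanishes, so no convolution has to be differentiated in \<open>h\<close>.\<close>

lemma cross_antiderivative:
  fixes p a b h :: real
  defines "R \<equiv> \<lambda>s. exp (p * s) * Phi [a, b, - p - a] s"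
    and "G \<equiv> \<lambda>s. exp (p * s) * Phi [a, b, - p - a, - p - b] s"
  shows "((\<lambda>s. Phi [a, b] (s - h) * R s - exp (b * (s - h)) * G s) has_real_derivative
           Phi [a, b] s * Phi [a, b] (s - h) * exp (p * s)) (at s)"
proof -
  have R: "(R has_real_derivative - a * R s + exp (p * s) * Phi [a, b] s) (at s)"
    using exp_mult_first_order[OF Phi_snoc_deriv[of "[a, b]" "- p - a" s], of p]
    by (simp add: R_def)
  have G: "(G has_real_derivative - b * G s + R s) (at s)"
    using exp_mult_first_order[OF Phi_snoc_deriv[of "[a, b, - p - a]" "- p - b" s], of p]
    by (simp add: G_def R_def)
  \<comment> \<open>The form with \<open>a\<close> in front is the right one: its term cancels the
    \<open>- a * R s\<close> in the derivative of \<open>R\<close>, and the exponential it leaves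
    behind is absorbed by \<open>G\<close>.\<close>
  have P: "((\<lambda>s. Phi [a, b] (s - h)) has_real_derivative
      (a * Phi [a, b] (s - h) + exp (b * (s - h)))) (at s)"
    using Phi2_deriv'[of a b "s + - h"] unfolding DERIV_shift by simp
  have E: "((\<lambda>s. exp (b * (s - h))) has_real_derivative b * exp (b * (s - h))) (at s)"
    by (auto intro!: derivative_eq_intros)
  show ?thesis
    by (rule DERIV_cong[OF DERIV_diff[OF DERIV_mult[OF P R] DERIV_mult[OF E G]]])
       (simp add: algebra_simps)
qed

lemma cross_integral:
  "((\<lambda>x. c * (Phi [a, b] (x - r) * Phi [a, b] (x - r - h) * exp (p * (x - r)))) has_integral
      sgn h * (c * - (exp (p * h) * Phi [a, b, - p - a, - p - b] h))) {min r (r + h)..max r (r + h)}"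
  using oriented_ftc[where f = "\<lambda>s. Phi [a, b] s * Phi [a, b] (s - h) * exp (p * s)" and c = c and r = r and h = h,
      OF cross_antiderivative]
    Phi_snoc_0[of "[a, b]" "- p - a"] Phi_snoc_0[of "[a, b, - p - a]" "- p - b"]
  by simp

lemma linear_integral:
  "((\<lambda>x. c * (Phi [a, b] (x - r) * exp (p * (x - r)))) has_integral
      sgn h * (c * (exp (p * h) * Phi [a, b, - p] h))) {min r (r + h)..max r (r + h)}"
proof -
  have "((\<lambda>s. exp (p * s) * Phi [a, b, - p] s) has_real_derivative Phi [a, b] s * exp (p * s)) (at s)" for s
    using exp_mult_first_order[OF Phi_snoc_deriv[of "[a, b]" "- p" s], of p]
    by (simp add: mult.commute)
  from oriented_ftc[where f = "\<lambda>s. Phi [a, b] s * exp (p * s)" and c = c and r = r and h = h, OF this]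
  show ?thesis using Phi_snoc_0[of "[a, b]" "- p"] by simp
qed

text \<open>By \<open>Phi3_square\<close> the square is \<open>2 * exp ((a + b) * s)\<close> times a
  fundamental function. The total weight exponent is thus \<open>p + a + b\<close>, and its negative
  is the frequency to append.\<close>

lemma square_integral:
  "((\<lambda>x. c * ((Phi [a, b] (x - r))\<^sup>2 * exp (p * (x - r)))) has_integral
      sgn h * (c * (2 * exp ((p + a + b) * h) * Phi [a - b, b - a, 0, - p - a - b] h)))
      {min r (r + h)..max r (r + h)}"
proof -
  have "((\<lambda>s. 2 * exp ((p + a + b) * s) * Phi [a - b, b - a, 0, - p - a - b] s) has_real_derivative
          (Phi [a, b] s)\<^sup>2 * exp (p * s)) (at s)" for s
  proof -
    have e: "exp ((p + a + b) * s) * exp (- ((a + b) * s)) = exp (p * s)"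
      by (simp add: algebra_simps flip: exp_add)
    have "((\<lambda>s. 2 * (exp ((p + a + b) * s) * Phi [a - b, b - a, 0, - p - a - b] s)) has_real_derivative
            2 * (exp ((p + a + b) * s) * Phi [a - b, b - a, 0] s)) (at s)"
      using exp_mult_first_order[OF Phi_snoc_deriv[of "[a - b, b - a, 0]" "- p - a - b" s], of "p + a + b"]
      by (intro DERIV_cmult) simp
    then show ?thesis by (simp add: Phi3_square mult_ac flip: e)
  qed
  from oriented_ftc[where f = "\<lambda>s. (Phi [a, b] s)\<^sup>2 * exp (p * s)" and c = c and r = r and h = h, OF this]
  show ?thesis using Phi_snoc_0[of "[a - b, b - a, 0]" "- p - a - b"] by simp
qed

lemma continuous_on_Phi2: "continuous_on A (Phi [a, b])"
  by (rule DERIV_continuous_on) (rule has_field_derivative_at_within, rule Phi2_deriv)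

lemma continuous_on_Phi2_shift: "continuous_on A (\<lambda>x. Phi [a, b] (x - r))"
  by (rule continuous_on_compose2[OF continuous_on_Phi2[of UNIV]]) (auto intro: continuous_intros)

text \<open>\<open>f\<close> is 0 at \<open>r\<close> and 1 at \<open>r + h\<close>, and
  \<open>g\<close> the reverse. Since \<open>h\<close> may be negative, \<open>f\<close> can stand
  for either hat of the edge.\<close>

lemma edge_integrals:
  fixes p a b r h :: real
  assumes h: "h \<noteq> 0" "Phi [a, b] h \<noteq> 0"
  defines "I \<equiv> {min r (r + h)..max r (r + h)}"
    and "f \<equiv> \<lambda>x. Phi [a, b] (x - r) / Phi [a, b] h"
    and "g \<equiv> \<lambda>x. Phi [a, b] (x - (r + h)) / Phi [a, b] (- h)"
  shows "integral I (\<lambda>x. f x * f x * exp (p * x)) > 0" (is ?pos)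
    and "integral I (\<lambda>x. f x * g x * exp (p * x))
           = Tfun p a b h * integral I (\<lambda>x. f x * f x * exp (p * x))" (is ?T)
    and "integral I (\<lambda>x. f x * exp (p * x))
           = Sfun p a b h * integral I (\<lambda>x. f x * f x * exp (p * x))" (is ?S)
proof -
  define K where "K = Phi [a - b, b - a, 0, - p - a - b] h"
  define P where "P = Phi [a, b] h"
  have P: "P \<noteq> 0" using h by (simp add: P_def)
  \<comment> \<open>Centring the weight at \<open>r\<close> isolates the factor
    \<open>exp (p * r)\<close>, which is common to the three integrals and cancels in their
    ratios.\<close>
  have w: "exp (p * x) = exp (p * r) * exp (p * (x - r))" for x
    by (simp add: algebra_simps flip: exp_add)
  define X where "X = exp ((a + b) * h)"
  have X: "X > 0" by (simp add: X_def)
  have m: "Phi [a, b] (- h) = - (P / X)" "Phi [- a, - b] h = P / X"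
    unfolding P_def X_def Phi2_uminus_arg Phi2_uminus by (simp_all add: exp_minus divide_simps)
  have e: "exp ((p + a + b) * h) = exp (p * h) * X"
    by (simp add: X_def algebra_simps flip: exp_add)
  have "f x * f x * exp (p * x) = exp (p * r) / P\<^sup>2 * ((Phi [a, b] (x - r))\<^sup>2 * exp (p * (x - r)))" for x
    unfolding w[of x] by (simp add: f_def P_def power2_eq_square)
  then have ff: "integral I (\<lambda>x. f x * f x * exp (p * x))
      = sgn h * (exp (p * r) / P\<^sup>2 * (2 * exp ((p + a + b) * h) * K))"
    unfolding I_def K_def by (simp only: integral_unique[OF square_integral])
  have "f x * g x * exp (p * x) = exp (p * r) / (P * Phi [a, b] (- h)) *
      (Phi [a, b] (x - r) * Phi [a, b] (x - r - h) * exp (p * (x - r)))" for x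
    unfolding w[of x] by (simp add: f_def g_def P_def diff_diff_eq)
  then have fg: "integral I (\<lambda>x. f x * g x * exp (p * x))
      = sgn h * (exp (p * r) / (P * Phi [a, b] (- h)) *
         - (exp (p * h) * Phi [a, b, - p - a, - p - b] h))"
    unfolding I_def by (simp only: integral_unique[OF cross_integral])
  have "f x * exp (p * x) = exp (p * r) / P * (Phi [a, b] (x - r) * exp (p * (x - r)))" for x
    unfolding w[of x] by (simp add: f_def P_def)
  then have f1: "integral I (\<lambda>x. f x * exp (p * x))
      = sgn h * (exp (p * r) / P * (exp (p * h) * Phi [a, b, - p] h))"
    unfolding I_def by (simp only: integral_unique[OF linear_integral])
  have "continuous_on I f"
    unfolding f_def using h by (intro continuous_on_divide continuous_on_Phi2_shift continuous_on_const) simp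
  then have cont: "continuous_on I (\<lambda>x. f x * f x * exp (p * x))"
    by (intro continuous_on_mult continuous_on_exp continuous_on_const continuous_on_id)
  have "integral I (\<lambda>x. f x * f x * exp (p * x)) \<noteq> 0"
  proof
    assume "integral I (\<lambda>x. f x * f x * exp (p * x)) = 0"
    moreover have "min r (r + h) < max r (r + h)" using h by linarith
    ultimately have "\<forall>x\<in>I. f x * f x * exp (p * x) = 0"
      using integral_eq_0_iff[OF cont[unfolded I_def]] unfolding I_def by simp
    moreover have "r + h \<in> I" by (simp add: I_def)
    ultimately have "f (r + h) * f (r + h) * exp (p * (r + h)) = 0" by blast
    then show False using h by (simp add: f_def)
  qed
  moreover have "integral I (\<lambda>x. f x * f x * exp (p * x)) \<ge> 0"
    using cont unfolding I_def by (intro integral_nonneg integrable_continuous_interval) auto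
  ultimately show ?pos by simp
  \<comment> \<open>Positivity of the integral of the square excludes a vanishing denominator in
    \<open>Tfun\<close> and \<open>Sfun\<close>.\<close>
  then have K: "K \<noteq> 0" unfolding ff by auto
  show ?T unfolding fg ff m Tfun_def e K_def[symmetric] using K P X
    by (simp add: field_simps power2_eq_square)
  show ?S unfolding f1 ff Sfun_def e K_def[symmetric] m P_def[symmetric] using K P X
    by (simp add: field_simps power2_eq_square)
qed

section \<open>Diagonally dominant tridiagonal systems\<close>

text \<open>In the row where the modulus is maximal, equal to X, dominance gives X s_ii \<le> m s_ii
  + c X s_ii. Scaling the right-hand side by \<open>s i i\<close> lets the diagonal cancel, so no
  lower bound for it enters.\<close>

lemma row_diag_dom_bound:
  fixes s :: "nat \<Rightarrow> nat \<Rightarrow> real"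
  assumes dom: "row_diag_dom n s c" and c: "c < 1"
    and sym: "\<And>i j. s i j = s j i"
    and tri: "\<And>i j. Suc i < j \<Longrightarrow> s i j = 0"
    and pos: "\<And>i. i \<in> {1..n} \<Longrightarrow> s i i > 0"
    and x: "\<And>i. i \<in> {1..n} \<Longrightarrow> \<bar>\<Sum>j=1..n. x j * s i j\<bar> \<le> m * s i i"
    and k: "k \<in> {1..n}"
  shows "\<bar>x k\<bar> \<le> m / (1 - c)"
proof -
  define X where "X = Max ((\<lambda>i. \<bar>x i\<bar>) ` {1..n})"
  have "X \<in> (\<lambda>i. \<bar>x i\<bar>) ` {1..n}" unfolding X_def using k by (intro Max_in) auto
  then obtain i where i: "i \<in> {1..n}" and Xi: "X = \<bar>x i\<bar>" by blast
  have X: "\<bar>x j\<bar> \<le> X" if "j \<in> {1..n}" for j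
    unfolding X_def using that by (intro Max_ge) auto
  have "(\<Sum>j\<in>{1..n} - {i}. \<bar>s i j\<bar>) = (\<Sum>j\<in>({1..n} - {i}) \<inter> {i - 1, i + 1}. \<bar>s i j\<bar>)"
  proof (rule sum.mono_neutral_right)
    show "\<forall>j\<in>{1..n} - {i} - ({1..n} - {i}) \<inter> {i - 1, i + 1}. \<bar>s i j\<bar> = 0"
    proof
      fix j assume "j \<in> {1..n} - {i} - ({1..n} - {i}) \<inter> {i - 1, i + 1}"
      then have "Suc i < j \<or> Suc j < i" by auto
      then show "\<bar>s i j\<bar> = 0" using tri[of i j] tri[of j i] sym[of i j] by auto
    qed
  qed auto
  \<comment> \<open>Admitting neighbours outside \<open>{1..n}\<close> only adds nonnegative terms,
    so the first and last rows are not special.\<close>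
  also have "\<dots> \<le> (\<Sum>j\<in>{i - 1, i + 1}. \<bar>s i j\<bar>)" by (intro sum_mono2) auto
  also have "\<dots> = \<bar>s (i - 1) i\<bar> + \<bar>s i (i + 1)\<bar>" using sym[of i "i - 1"] by simp
  also have "\<dots> \<le> c * s i i" using dom i pos[OF i] unfolding row_diag_dom_def by fastforce
  finally have off: "(\<Sum>j\<in>{1..n} - {i}. \<bar>s i j\<bar>) \<le> c * s i i" .
  have "\<bar>\<Sum>j\<in>{1..n} - {i}. x j * s i j\<bar> \<le> (\<Sum>j\<in>{1..n} - {i}. X * \<bar>s i j\<bar>)"
    by (rule order.trans[OF sum_abs sum_mono]) (auto simp: abs_mult intro!: mult_right_mono X)
  also have "\<dots> \<le> X * (c * s i i)"
    unfolding sum_distrib_left[symmetric] using off Xi by (intro mult_left_mono) auto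
  finally have "\<bar>x i * s i i\<bar> \<le> m * s i i + X * (c * s i i)"
    using x[OF i] sum.remove[of "{1..n}" i "\<lambda>j. x j * s i j"] i by (simp del: One_nat_def)
  then have "(X * (1 - c)) * s i i \<le> m * s i i"
    using pos[OF i] Xi by (simp add: abs_mult algebra_simps)
  then have "X * (1 - c) \<le> m" using pos[OF i] mult_le_cancel_right_pos by blast
  with X[OF k] c show ?thesis
    by (simp add: pos_le_divide_eq) (smt (verit) mult_right_mono)
qed

section \<open>The weighted inner product\<close>

lemma ipp_commute: "ipp p a b f g = ipp p a b g f"
  by (simp add: ipp_def mult.commute)

lemma ipp_integrable:
  fixes f g :: "real \<Rightarrow> real"
  assumes "continuous_on {a..b} f" "continuous_on {a..b} g"
  shows "(\<lambda>x. f x * g x * exp (p * x)) integrable_on {a..b}"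
  by (intro integrable_continuous_interval continuous_on_mult continuous_on_exp
      continuous_on_const continuous_on_id assms)

lemma ipp_diff_scale:
  assumes "continuous_on {a..b} f" "continuous_on {a..b} g" "continuous_on {a..b} h"
  shows "ipp p a b (\<lambda>x. f x - k * g x) h = ipp p a b f h - k * ipp p a b g h"
proof -
  have "ipp p a b (\<lambda>x. f x - k * g x) h
      = integral {a..b} (\<lambda>x. f x * h x * exp (p * x) - k * (g x * h x * exp (p * x)))"
    by (simp add: ipp_def algebra_simps)
  also have "\<dots> = integral {a..b} (\<lambda>x. f x * h x * exp (p * x))
      - integral {a..b} (\<lambda>x. k * (g x * h x * exp (p * x)))"
    by (intro integral_diff integrable_on_mult_right ipp_integrable assms)
  finally show ?thesis by (simp add: ipp_def)
qed

lemma ipp_sum: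
  assumes "finite J" "\<And>j. j \<in> J \<Longrightarrow> continuous_on {a..b} (e j)" "continuous_on {a..b} h"
  shows "ipp p a b (\<lambda>x. \<Sum>j\<in>J. c j * e j x) h = (\<Sum>j\<in>J. c j * ipp p a b (e j) h)"
proof -
  have "ipp p a b (\<lambda>x. \<Sum>j\<in>J. c j * e j x) h
      = integral {a..b} (\<lambda>x. \<Sum>j\<in>J. c j * (e j x * h x * exp (p * x)))"
    by (simp add: ipp_def sum_distrib_right mult.assoc)
  also have "\<dots> = (\<Sum>j\<in>J. integral {a..b} (\<lambda>x. c j * (e j x * h x * exp (p * x))))"
    by (intro integral_sum integrable_on_mult_right ipp_integrable assms)
  finally show ?thesis by (simp add: ipp_def)
qed

lemma continuous_on_lincomb:
  fixes e :: "nat \<Rightarrow> real \<Rightarrow> real"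
  assumes "\<And>j. j \<in> J \<Longrightarrow> continuous_on A (e j)"
  shows "continuous_on A (\<lambda>x. \<Sum>j\<in>J. c j * e j x)"
  by (intro continuous_on_sum continuous_on_mult continuous_on_const assms)

lemma ipp_self_zeroD:
  assumes "a < b" "continuous_on {a..b} f" "ipp p a b f f = 0" "x \<in> {a..b}"
  shows "f x = 0"
proof -
  have "continuous_on {a..b} (\<lambda>x. f x * f x * exp (p * x))"
    by (intro continuous_on_mult continuous_on_exp continuous_on_const continuous_on_id assms)
  from integral_eq_0_iff[OF this assms(1)] assms(3,4) show ?thesis
    by (auto simp: ipp_def)
qed

lemma supn_ge:
  assumes "continuous_on {a..b} f" "y \<in> {a..b}"
  shows "\<bar>f y\<bar> \<le> supn a b f"
proof -
  have "compact ((\<lambda>x. \<bar>f x\<bar>) ` {a..b})"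
    using assms(1) by (intro compact_continuous_image continuous_on_rabs) auto
  then have "bdd_above ((\<lambda>x. \<bar>f x\<bar>) ` {a..b})"
    by (intro bounded_imp_bdd_above compact_imp_bounded)
  then show ?thesis unfolding supn_def using assms(2) by (rule cSUP_upper2) simp
qed

text \<open>The functions need not be independent, because a residual of norm zero
  vanishes on the interval and is then orthogonal to everything.\<close>

lemma exists_orthogonal_projection:
  fixes e :: "nat \<Rightarrow> real \<Rightarrow> real"
  assumes "a < b" and e: "\<And>j. j \<in> {1..k} \<Longrightarrow> continuous_on {a..b} (e j)"
    and "continuous_on {a..b} f"
  shows "\<exists>c. \<forall>i\<in>{1..k}. ipp p a b (\<lambda>x. f x - (\<Sum>j=1..k. c j * e j x)) (e i) = 0"
  using e assms(3)
proof (induction k arbitrary: f)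
  case (Suc k)
  have e: "continuous_on {a..b} (e j)" if "j \<in> {1..Suc k}" for j using Suc.prems(1) that .
  obtain c where c: "\<forall>i\<in>{1..k}. ipp p a b (\<lambda>x. f x - (\<Sum>j=1..k. c j * e j x)) (e i) = 0"
    using Suc.IH[of f] Suc.prems by auto
  \<comment> \<open>The induction hypothesis is applied to the new function too: \<open>u\<close>
    below is \<open>e (Suc k)\<close> minus its projection onto the earlier functions, a
    Gram-Schmidt step.\<close>
  obtain d where d: "\<forall>i\<in>{1..k}. ipp p a b (\<lambda>x. e (Suc k) x - (\<Sum>j=1..k. d j * e j x)) (e i) = 0"
    using Suc.IH[of "e (Suc k)"] Suc.prems by auto
  define g where "g x = f x - (\<Sum>j=1..k. c j * e j x)" for x
  define u where "u x = e (Suc k) x - (\<Sum>j=1..k. d j * e j x)" for x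
  have cg: "continuous_on {a..b} g" and cu: "continuous_on {a..b} u"
    unfolding g_def u_def
    using e Suc.prems(2) by (intro continuous_on_diff continuous_on_lincomb; simp)+
  \<comment> \<open>If \<open>u\<close> has norm zero, division by zero gives \<open>al = 0\<close>;
    this is harmless because \<open>u\<close> then vanishes on the interval.\<close>
  define al where "al = ipp p a b g u / ipp p a b u u"
  have eu: "e (Suc k) = (\<lambda>x. u x - (-1) * (\<Sum>j=1..k. d j * e j x))"
    by (simp add: u_def)
  \<comment> \<open>\<open>u\<close> and \<open>e (Suc k)\<close> differ by a combination of the
    earlier functions, which \<open>v\<close> does not see.\<close>
  have orth: "ipp p a b v (e (Suc k)) = ipp p a b v u"
    if v: "continuous_on {a..b} v" "\<forall>i\<in>{1..k}. ipp p a b v (e i) = 0" for v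
  proof -
    have "ipp p a b (e (Suc k)) v = ipp p a b u v - (-1) * ipp p a b (\<lambda>x. \<Sum>j=1..k. d j * e j x) v"
      unfolding eu using cu v(1) e by (intro ipp_diff_scale continuous_on_lincomb) auto
    also have "ipp p a b (\<lambda>x. \<Sum>j=1..k. d j * e j x) v = (\<Sum>j=1..k. d j * ipp p a b (e j) v)"
      using v(1) e by (intro ipp_sum) auto
    also have "\<dots> = 0" using v(2) by (intro sum.neutral) (simp add: ipp_commute[of p a b _ v])
    finally show ?thesis by (simp add: ipp_commute[of p a b v])
  qed
  define r where "r x = g x - al * u x" for x
  have cr: "continuous_on {a..b} r"
    unfolding r_def using cg cu by (intro continuous_on_diff continuous_on_mult continuous_on_const)
  have r1: "ipp p a b r (e i) = 0" if i: "i \<in> {1..k}" for i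
  proof -
    have "ipp p a b g (e i) = 0" "ipp p a b u (e i) = 0"
      using c d i unfolding g_def u_def by blast+
    then show ?thesis
      unfolding r_def using ipp_diff_scale[OF cg cu e[of i], of p al] i by simp
  qed
  have "ipp p a b r u = ipp p a b g u - al * ipp p a b u u"
    unfolding r_def by (rule ipp_diff_scale[OF cg cu cu])
  also have "\<dots> = 0"
  proof (cases "ipp p a b u u = 0")
    case True
    then have "u x = 0" if "x \<in> {a..b}" for x using ipp_self_zeroD[OF \<open>a < b\<close> cu] that by blast
    then have "ipp p a b g u = integral {a..b} (\<lambda>x. 0)"
      unfolding ipp_def by (intro integral_cong) simp
    then show ?thesis using True by simp
  qed (simp add: al_def)
  finally have r2: "ipp p a b r (e (Suc k)) = 0" using orth[OF cr] r1 by simp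
  define c' where "c' j = (if j = Suc k then al else c j - al * d j)" for j
  have "(\<Sum>j=1..k. c' j * e j x) = (\<Sum>j=1..k. c j * e j x) - al * (\<Sum>j=1..k. d j * e j x)" for x
    unfolding sum_distrib_left sum_subtractf[symmetric]
    by (intro sum.cong) (auto simp: c'_def algebra_simps)
  then have "f x - (\<Sum>j=1..Suc k. c' j * e j x) = r x" for x
    by (simp add: r_def g_def u_def algebra_simps) (simp add: c'_def)
  then have "\<forall>i\<in>{1..Suc k}. ipp p a b (\<lambda>x. f x - (\<Sum>j=1..Suc k. c' j * e j x)) (e i) = 0"
    using r1 r2 by (auto simp: le_Suc_eq simp del: sum.cl_ivl_Suc)
  then show ?case by blast
qed simp

section \<open>Generalized hat functions\<close>

text \<open>The exponential form of the pieces is left aside here. Monotonicity is asked on a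
  symmetric interval because rising pieces evaluate \<open>phi j\<close> at positive arguments and
  falling pieces at negative ones.\<close>

locale hat_basis =
  fixes n :: nat and t :: "nat \<Rightarrow> real" and phi :: "nat \<Rightarrow> real \<Rightarrow> real"
  assumes n: "2 \<le> n"
    and step: "\<And>j. 1 \<le> j \<Longrightarrow> j < n \<Longrightarrow> t j < t (Suc j)"
    and phi_cont: "\<And>j. 1 \<le> j \<Longrightarrow> j < n \<Longrightarrow> continuous_on UNIV (phi j)"
    and phi_0: "\<And>j. 1 \<le> j \<Longrightarrow> j < n \<Longrightarrow> phi j 0 = 0"
    and phi_mono: "\<And>j. 1 \<le> j \<Longrightarrow> j < n \<Longrightarrow>
      strict_mono_on {- (t (Suc j) - t j)..t (Suc j) - t j} (phi j)"
begin

abbreviation H :: "nat \<Rightarrow> real \<Rightarrow> real" where "H \<equiv> hat t phi n"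

text \<open>Edges carry the index of their left node, so edge \<open>j\<close> holds the rising
  piece of hat \<open>Suc j\<close> and the falling piece of hat \<open>j\<close>.\<close>

definition rise :: "nat \<Rightarrow> real \<Rightarrow> real" where
  "rise j x = phi j (x - t j) / phi j (t (Suc j) - t j)"

definition fall :: "nat \<Rightarrow> real \<Rightarrow> real" where
  "fall j x = phi j (x - t (Suc j)) / phi j (t j - t (Suc j))"

lemma t_less: "1 \<le> i \<Longrightarrow> i < j \<Longrightarrow> j \<le> n \<Longrightarrow> t i < t j"
proof (induction j)
  case (Suc j)
  then show ?case using step[of j] by (cases "i = j") auto
qed simp

lemma t_le: "1 \<le> i \<Longrightarrow> i \<le> j \<Longrightarrow> j \<le> n \<Longrightarrow> t i \<le> t j"
  using t_less[of i j] by (cases "i = j") auto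

lemma t_1_n: "t 1 < t n"
  using n t_less[of 1 n] by simp

lemma phi_pos:
  assumes "1 \<le> j" "j < n" "0 < s" "s \<le> t (Suc j) - t j"
  shows "phi j s > 0"
  using strict_mono_onD[OF phi_mono[OF assms(1,2)], of 0 s] assms phi_0 by simp

lemma phi_neg:
  assumes "1 \<le> j" "j < n" "s < 0" "- (t (Suc j) - t j) \<le> s"
  shows "phi j s < 0"
  using strict_mono_onD[OF phi_mono[OF assms(1,2)], of s 0] assms phi_0 by simp

lemma rise_bounds:
  assumes j: "1 \<le> j" "j < n" and x: "x \<in> {t j..t (Suc j)}"
  shows "0 \<le> rise j x" "rise j x \<le> 1"
proof -
  have P: "phi j (t (Suc j) - t j) > 0" using phi_pos[OF j] step[OF j] by simp
  have "0 \<le> phi j (x - t j)"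
    using phi_pos[OF j, of "x - t j"] phi_0[OF j] x by (cases "x = t j") auto
  moreover have "phi j (x - t j) \<le> phi j (t (Suc j) - t j)"
    using strict_mono_onD[OF phi_mono[OF j], of "x - t j" "t (Suc j) - t j"] x
    by (cases "x = t (Suc j)") auto
  ultimately show "0 \<le> rise j x" "rise j x \<le> 1" using P by (simp_all add: rise_def)
qed

lemma fall_bounds:
  assumes j: "1 \<le> j" "j < n" and x: "x \<in> {t j..t (Suc j)}"
  shows "0 \<le> fall j x" "fall j x \<le> 1"
proof -
  have P: "phi j (t j - t (Suc j)) < 0" using phi_neg[OF j] step[OF j] by simp
  have "phi j (x - t (Suc j)) \<le> 0"
    using phi_neg[OF j, of "x - t (Suc j)"] phi_0[OF j] x by (cases "x = t (Suc j)") auto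
  moreover have "phi j (t j - t (Suc j)) \<le> phi j (x - t (Suc j))"
    using strict_mono_onD[OF phi_mono[OF j], of "t j - t (Suc j)" "x - t (Suc j)"] x
    by (cases "x = t j") auto
  ultimately show "0 \<le> fall j x" "fall j x \<le> 1" using P
    by (simp_all add: fall_def divide_nonpos_nonpos divide_le_eq)
qed

lemma H_rise:
  assumes "1 \<le> j" "j < n" "x \<in> {t j..t (Suc j)}"
  shows "H (Suc j) x = rise j x"
  using assms by (simp add: hat_def rise_def)

text \<open>The order of the cases in \<open>hat\<close> matters only at the node
  \<open>t j\<close>, where the first branch wins; both branches give 1 there.\<close>

lemma H_fall:
  assumes j: "1 \<le> j" "j < n" and x: "x \<in> {t j..t (Suc j)}"
  shows "H j x = fall j x"
proof (cases "2 \<le> j \<and> t (j - 1) \<le> x \<and> x \<le> t j")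
  case True
  then have [simp]: "x = t j" using x by auto
  have "phi (j - 1) (t j - t (j - 1)) > 0"
    using phi_pos[of "j - 1" "t j - t (j - 1)"] step[of "j - 1"] True j by fastforce
  moreover have "phi j (t j - t (Suc j)) < 0" using phi_neg[OF j] step[OF j] by simp
  ultimately show ?thesis using True by (simp add: hat_def fall_def)
next
  case False
  moreover have "j \<le> n - 1" using j by simp
  ultimately show ?thesis using x by (auto simp: hat_def fall_def Suc_eq_plus1 simp del: One_nat_def)
qed

text \<open>The closed support of \<open>H i\<close> may still touch the edge in one node; there the
  formula yields \<open>phi\<close> at 0, which is 0.\<close>

lemma H_zero:
  assumes j: "1 \<le> j" "j < n" and x: "x \<in> {t j..t (Suc j)}"
    and i: "1 \<le> i" "i \<le> n" "i \<noteq> j" "i \<noteq> Suc j"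
  shows "H i x = 0"
proof (cases "i < j")
  case True
  then have le: "t i < t j" "t (Suc i) \<le> t j" using t_less[of i j] t_le[of "Suc i" j] i j by auto
  have "phi i (x - t (Suc i)) = 0" if "x \<le> t (Suc i)"
  proof -
    have "x = t (Suc i)" using that x le by simp
    then show ?thesis using phi_0[of i] i j True by simp
  qed
  then show ?thesis using x le by (auto simp: hat_def)
next
  case False
  then have le: "t (Suc j) < t i" "t (Suc j) \<le> t (i - 1)"
    using t_less[of "Suc j" i] t_le[of "Suc j" "i - 1"] i j by auto
  have "phi (i - 1) (x - t (i - 1)) = 0" if "t (i - 1) \<le> x"
  proof -
    have "x = t (i - 1)" using that x le by simp
    moreover have "1 \<le> i - 1" "i - 1 < n" using False i j by auto
    ultimately show ?thesis using phi_0[of "i - 1"] by simp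
  qed
  then show ?thesis using x le by (auto simp: hat_def)
qed

lemma edge_cover:
  assumes "x \<in> {t 1..t n}"
  obtains j where "1 \<le> j" "j < n" "x \<in> {t j..t (Suc j)}"
proof -
  have "\<exists>j. 1 \<le> j \<and> j < k \<and> x \<in> {t j..t (Suc j)}" if "2 \<le> k" "x \<in> {t 1..t k}" for k
    using that
  proof (induction k)
    case (Suc k)
    show ?case
    proof (cases "x \<le> t k \<and> 2 \<le> k")
      case True
      with Suc show ?thesis by fastforce
    next
      case False
      with Suc.prems have "1 \<le> k" "x \<in> {t k..t (Suc k)}"
        by (cases "k = 1"; auto)+
      then show ?thesis by blast
    qed
  qed simp
  from this[OF n assms] show ?thesis using that by blast
qed

lemma H_bounds:
  assumes "x \<in> {t 1..t n}" "i \<in> {1..n}"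
  shows "0 \<le> H i x" "H i x \<le> 1"
proof -
  obtain j where j: "1 \<le> j" "j < n" "x \<in> {t j..t (Suc j)}" using edge_cover assms(1) .
  have "i = j \<or> i = Suc j \<or> H i x = 0" using H_zero[OF j] assms(2) by auto
  then show "0 \<le> H i x" "H i x \<le> 1"
    using rise_bounds[OF j] fall_bounds[OF j] H_rise[OF j] H_fall[OF j] by auto
qed

lemma continuous_on_edges:
  fixes f :: "real \<Rightarrow> real"
  assumes "\<And>j. 1 \<le> j \<Longrightarrow> j < n \<Longrightarrow> continuous_on {t j..t (Suc j)} f"
  shows "continuous_on {t 1..t n} f"
proof -
  have "continuous_on {t 1..t k} f" if "1 \<le> k" "k \<le> n" for k
    using that
  proof (induction k rule: dec_induct)
    case (step k)
    have "{t 1..t (Suc k)} = {t 1..t k} \<union> {t k..t (Suc k)}"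
      using t_le[of 1 k] t_le[of k "Suc k"] step by auto
    then show ?case using step assms[of k] by (auto intro: continuous_on_closed_Un)
  qed auto
  then show ?thesis using n by simp
qed

lemma continuous_on_rise: "1 \<le> j \<Longrightarrow> j < n \<Longrightarrow> continuous_on A (rise j)"
  and continuous_on_fall: "1 \<le> j \<Longrightarrow> j < n \<Longrightarrow> continuous_on A (fall j)"
proof -
  assume j: "1 \<le> j" "j < n"
  have c: "continuous_on A (\<lambda>x. phi j (x - r))" for r
    by (rule continuous_on_compose2[OF phi_cont[OF j]]) (auto intro: continuous_on_diff)
  have "phi j (t (Suc j) - t j) \<noteq> 0" "phi j (t j - t (Suc j)) \<noteq> 0"
    using phi_pos[OF j, of "t (Suc j) - t j"] phi_neg[OF j, of "t j - t (Suc j)"] step[OF j] by auto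
  then show "continuous_on A (rise j)" "continuous_on A (fall j)"
    unfolding rise_def fall_def by (intro continuous_on_divide c continuous_on_const; simp)+
qed

lemma continuous_on_H:
  assumes "i \<in> {1..n}"
  shows "continuous_on {t 1..t n} (H i)"
proof (rule continuous_on_edges)
  fix j assume j: "1 \<le> j" "j < n"
  consider "i = j" | "i = Suc j" | "i \<noteq> j" "i \<noteq> Suc j" by blast
  then show "continuous_on {t j..t (Suc j)} (H i)"
  proof cases
    case 1
    then show ?thesis using H_fall[OF j] by (intro continuous_on_eq[OF continuous_on_fall[OF j]]) simp
  next
    case 2
    then show ?thesis using H_rise[OF j] by (intro continuous_on_eq[OF continuous_on_rise[OF j]]) simp
  next
    case 3
    then have "0 = H i x" if "x \<in> {t j..t (Suc j)}" for x
      using H_zero[OF j that] assms by simp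
    then show ?thesis by (rule continuous_on_eq[OF continuous_on_const])
  qed
qed

lemma integral_edges:
  fixes F :: "real \<Rightarrow> real"
  assumes "continuous_on {t 1..t n} F"
  shows "integral {t 1..t n} F = (\<Sum>j=1..<n. integral {t j..t (Suc j)} F)"
proof -
  have "integral {t 1..t k} F = (\<Sum>j=1..<k. integral {t j..t (Suc j)} F)" if "1 \<le> k" "k \<le> n" for k
    using that
  proof (induction k rule: dec_induct)
    case (step k)
    have "F integrable_on {t 1..t (Suc k)}"
      using t_le[of "Suc k" n] step
      by (intro integrable_continuous_interval continuous_on_subset[OF assms]) auto
    then have "integral {t 1..t (Suc k)} F = integral {t 1..t k} F + integral {t k..t (Suc k)} F"
      using t_le[of 1 k] t_le[of k "Suc k"] step by (intro Henstock_Kurzweil_Integration.integral_combine[symmetric]) auto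
    then show ?case using step by simp
  qed simp
  then show ?thesis using n by simp
qed

text \<open>Stated for general \<open>F\<close> to serve both the squares (y * y) and the hats
  themselves (y); \<open>F 0 = 0\<close> removes the edges off the support.\<close>

lemma integral_H_split:
  fixes F :: "real \<Rightarrow> real"
  assumes i: "i \<in> {1..n}" and F: "continuous_on UNIV F" "F 0 = 0"
  shows "integral {t 1..t n} (\<lambda>x. F (H i x) * exp (p * x))
    = (if 2 \<le> i then integral {t (i - 1)..t i} (\<lambda>x. F (rise (i - 1) x) * exp (p * x)) else 0)
    + (if i < n then integral {t i..t (Suc i)} (\<lambda>x. F (fall i x) * exp (p * x)) else 0)"
proof -
  let ?E = "\<lambda>j. integral {t j..t (Suc j)} (\<lambda>x. F (H i x) * exp (p * x))"
  let ?R = "\<lambda>j. integral {t j..t (Suc j)} (\<lambda>x. F (rise j x) * exp (p * x))"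
  let ?L = "\<lambda>j. integral {t j..t (Suc j)} (\<lambda>x. F (fall j x) * exp (p * x))"
  have "continuous_on {t 1..t n} (\<lambda>x. F (H i x))"
    by (rule continuous_on_compose2[OF F(1) continuous_on_H[OF i]]) simp
  then have "continuous_on {t 1..t n} (\<lambda>x. F (H i x) * exp (p * x))"
    by (intro continuous_on_mult continuous_on_exp continuous_on_const continuous_on_id)
  from integral_edges[OF this]
  have "integral {t 1..t n} (\<lambda>x. F (H i x) * exp (p * x)) = (\<Sum>j=1..<n. ?E j)" .
  also have "\<dots> = (\<Sum>j=1..<n. (if j = i - 1 then ?R j else 0) + (if j = i then ?L j else 0))"
  proof (rule sum.cong)
    fix j assume "j \<in> {1..<n}"
    then have j: "1 \<le> j" "j < n" by auto
    consider "i = j" | "i = Suc j" | "i \<noteq> j" "i \<noteq> Suc j" by blast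
    then show "?E j = (if j = i - 1 then ?R j else 0) + (if j = i then ?L j else 0)"
    proof cases
      case 1
      then have "?E j = ?L j" using H_fall[OF j] by (intro integral_cong) auto
      then show ?thesis using 1 j by auto
    next
      case 2
      then have "?E j = ?R j" using H_rise[OF j] by (intro integral_cong) auto
      then show ?thesis using 2 by auto
    next
      case 3
      then have "?E j = integral {t j..t (Suc j)} (\<lambda>x. 0)"
        using H_zero[OF j _ _ _ 3] i F(2) by (intro integral_cong) auto
      then show ?thesis using 3 i by auto
    qed
  qed simp
  \<comment> \<open>For \<open>i = 1\<close> the index \<open>i - 1\<close> is 0, outside the range
    of edges: the end hats have one piece only.\<close>
  also have "\<dots> = (if i - 1 \<in> {1..<n} then ?R (i - 1) else 0) + (if i \<in> {1..<n} then ?L i else 0)"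
    by (simp add: sum.distrib sum.delta)
  also have "\<dots> = (if 2 \<le> i then ?R (i - 1) else 0) + (if i < n then ?L i else 0)"
    using i by auto
  finally show ?thesis using i by (cases i) auto
qed

section \<open>The Gram matrix of the hats and the projection\<close>

lemma gram_commute: "gram p t phi n i j = gram p t phi n j i"
  by (simp add: gram_def ipp_commute)

lemma ipp_H_eq_edge:
  assumes j: "1 \<le> j" "j < n"
  shows "ipp p (t 1) (t n) (H j) (H (Suc j))
    = integral {t j..t (Suc j)} (\<lambda>x. rise j x * fall j x * exp (p * x))"
proof -
  have "continuous_on {t 1..t n} (\<lambda>x. H j x * H (Suc j) x * exp (p * x))"
    using j by (intro continuous_on_mult continuous_on_exp continuous_on_const continuous_on_id continuous_on_H) auto
  from integral_edges[OF this]
  have "ipp p (t 1) (t n) (H j) (H (Suc j))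
      = (\<Sum>k=1..<n. integral {t k..t (Suc k)} (\<lambda>x. H j x * H (Suc j) x * exp (p * x)))"
    by (simp add: ipp_def)
  also have "\<dots> = (\<Sum>k=1..<n. if k = j then integral {t k..t (Suc k)} (\<lambda>x. rise k x * fall k x * exp (p * x)) else 0)"
  proof (rule sum.cong)
    fix k assume "k \<in> {1..<n}"
    then have k: "1 \<le> k" "k < n" by auto
    show "integral {t k..t (Suc k)} (\<lambda>x. H j x * H (Suc j) x * exp (p * x))
       = (if k = j then integral {t k..t (Suc k)} (\<lambda>x. rise k x * fall k x * exp (p * x)) else 0)"
    proof (cases "k = j")
      case True
      then show ?thesis using H_rise[OF k] H_fall[OF k] by (auto intro!: integral_cong)
    next
      case False
      have "H j x * H (Suc j) x = 0" if "x \<in> {t k..t (Suc k)}" for x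
        using H_zero[OF k that, of j] H_zero[OF k that, of "Suc j"] False j by (cases "j = Suc k") auto
      then have "integral {t k..t (Suc k)} (\<lambda>x. H j x * H (Suc j) x * exp (p * x))
          = integral {t k..t (Suc k)} (\<lambda>x. 0)"
        by (intro integral_cong) simp
      then show ?thesis using False by simp
    qed
  qed simp
  also have "\<dots> = integral {t j..t (Suc j)} (\<lambda>x. rise j x * fall j x * exp (p * x))"
    using j by simp
  finally show ?thesis .
qed

lemma gram_far: "Suc i < j \<Longrightarrow> gram p t phi n i j = 0"
proof -
  assume ij: "Suc i < j"
  show "gram p t phi n i j = 0"
  proof (cases "i \<in> {1..n} \<and> j \<in> {1..n}")
    case True
    have "H i x * H j x * exp (p * x) = 0" if x: "x \<in> {t 1..t n}" for x
    proof -
      obtain k where k: "1 \<le> k" "k < n" "x \<in> {t k..t (Suc k)}" using edge_cover x .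
      then show ?thesis using H_zero[OF k, of i] H_zero[OF k, of j] ij True by force
    qed
    then have "ipp p (t 1) (t n) (H i) (H j) = integral {t 1..t n} (\<lambda>x. 0)"
      unfolding ipp_def by (rule integral_cong)
    then show ?thesis using True by (simp add: gram_def)
  qed (auto simp: gram_def)
qed

end

text \<open>The analytic input for one edge. The mixed integral is compared with both squares since
  it occurs in two rows: row \<open>j\<close> contains the square of \<open>fall j\<close>, row
  \<open>Suc j\<close> that of \<open>rise j\<close>.\<close>

locale hat_gram = hat_basis +
  fixes p c :: real
  assumes c: "0 \<le> c" "c < 1"
    and rise_pos: "\<And>j. 1 \<le> j \<Longrightarrow> j < n \<Longrightarrow>
      0 < integral {t j..t (Suc j)} (\<lambda>x. rise j x * rise j x * exp (p * x))"
    and fall_pos: "\<And>j. 1 \<le> j \<Longrightarrow> j < n \<Longrightarrow>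
      0 < integral {t j..t (Suc j)} (\<lambda>x. fall j x * fall j x * exp (p * x))"
    and cross_rise: "\<And>j. 1 \<le> j \<Longrightarrow> j < n \<Longrightarrow>
      \<bar>integral {t j..t (Suc j)} (\<lambda>x. rise j x * fall j x * exp (p * x))\<bar>
        \<le> c * integral {t j..t (Suc j)} (\<lambda>x. rise j x * rise j x * exp (p * x))"
    and cross_fall: "\<And>j. 1 \<le> j \<Longrightarrow> j < n \<Longrightarrow>
      \<bar>integral {t j..t (Suc j)} (\<lambda>x. rise j x * fall j x * exp (p * x))\<bar>
        \<le> c * integral {t j..t (Suc j)} (\<lambda>x. fall j x * fall j x * exp (p * x))"
begin

abbreviation s :: "nat \<Rightarrow> nat \<Rightarrow> real" where "s \<equiv> gram p t phi n"

lemma gram_diag: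
  assumes "i \<in> {1..n}"
  shows "s i i
    = (if 2 \<le> i then integral {t (i - 1)..t i} (\<lambda>x. rise (i - 1) x * rise (i - 1) x * exp (p * x)) else 0)
    + (if i < n then integral {t i..t (Suc i)} (\<lambda>x. fall i x * fall i x * exp (p * x)) else 0)"
proof -
  have "continuous_on UNIV (\<lambda>y::real. y * y)" by (intro continuous_on_mult continuous_on_id)
  from integral_H_split[OF assms this] show ?thesis using assms by (simp add: gram_def ipp_def)
qed

lemma gram_diag_pos:
  assumes "i \<in> {1..n}"
  shows "s i i > 0"
proof -
  have "2 \<le> i \<Longrightarrow> 0 < integral {t (i - 1)..t i} (\<lambda>x. rise (i - 1) x * rise (i - 1) x * exp (p * x))"
    using rise_pos[of "i - 1"] assms by auto
  then show ?thesis
    unfolding gram_diag[OF assms] using fall_pos[of i] assms n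
    by (cases "2 \<le> i"; cases "i < n") (auto intro: add_pos_pos)
qed

lemma gram_row_diag_dom: "row_diag_dom n s c"
  unfolding row_diag_dom_def
proof
  fix i assume i: "i \<in> {1..n}"
  have "\<bar>s (i - 1) i\<bar>
      \<le> c * (if 2 \<le> i then integral {t (i - 1)..t i} (\<lambda>x. rise (i - 1) x * rise (i - 1) x * exp (p * x)) else 0)"
    using cross_rise[of "i - 1"] ipp_H_eq_edge[of "i - 1" p] i by (auto simp: gram_def)
  moreover have "\<bar>s i (i + 1)\<bar>
      \<le> c * (if i < n then integral {t i..t (Suc i)} (\<lambda>x. fall i x * fall i x * exp (p * x)) else 0)"
    using cross_fall[of i] ipp_H_eq_edge[of i p] i by (auto simp: gram_def)
  ultimately have "\<bar>s (i - 1) i\<bar> + \<bar>s i (i + 1)\<bar> \<le> c * s i i"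
    unfolding gram_diag[OF i] by (simp add: distrib_left)
  then show "\<bar>s (i - 1) i\<bar> + \<bar>s i (i + 1)\<bar> \<le> c * \<bar>s i i\<bar>"
    using gram_diag_pos[OF i] by simp
qed

text \<open>Used twice: with \<open>m = 0\<close> it makes the projection unique, with
  \<open>m = N * M\<close> it bounds the coefficients.\<close>

lemma coefficient_bound:
  assumes "\<And>i. i \<in> {1..n} \<Longrightarrow> \<bar>\<Sum>j=1..n. x j * s i j\<bar> \<le> m * s i i" "k \<in> {1..n}"
  shows "\<bar>x k\<bar> \<le> m / (1 - c)"
  using gram_row_diag_dom c(2) gram_commute gram_far gram_diag_pos assms by (rule row_diag_dom_bound)

text \<open>\<open>projH\<close> asks for uniqueness as a function on the whole line, while the
  inner product sees only \<open>{t 1..t n}\<close>. Comparing coefficients bridges this: their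
  differences solve the homogeneous Gram system and hence vanish.\<close>

lemma projH_coefficients:
  assumes f: "continuous_on {t 1..t n} f"
  obtains x where "projH p t phi n f = (\<lambda>y. \<Sum>j=1..n. x j * H j y)"
    "\<And>i. i \<in> {1..n} \<Longrightarrow> (\<Sum>j=1..n. x j * s i j) = ipp p (t 1) (t n) f (H i)"
proof -
  have lin: "ipp p (t 1) (t n) (\<lambda>y. f y - (\<Sum>j=1..n. x j * H j y)) (H i)
      = ipp p (t 1) (t n) f (H i) - (\<Sum>j=1..n. x j * s i j)" if i: "i \<in> {1..n}" for x i
  proof -
    have "ipp p (t 1) (t n) (\<lambda>y. f y - 1 * (\<Sum>j=1..n. x j * H j y)) (H i)
      = ipp p (t 1) (t n) f (H i) - 1 * ipp p (t 1) (t n) (\<lambda>y. \<Sum>j=1..n. x j * H j y) (H i)"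
      using i by (intro ipp_diff_scale f continuous_on_lincomb continuous_on_H) auto
    also have "ipp p (t 1) (t n) (\<lambda>y. \<Sum>j=1..n. x j * H j y) (H i)
      = (\<Sum>j=1..n. x j * ipp p (t 1) (t n) (H j) (H i))"
      using i by (intro ipp_sum continuous_on_H) auto
    also have "\<dots> = (\<Sum>j=1..n. x j * s i j)"
      using i by (intro sum.cong) (auto simp: gram_def ipp_commute)
    finally show ?thesis by simp
  qed
  obtain x where x: "\<And>i. i \<in> {1..n} \<Longrightarrow>
      ipp p (t 1) (t n) (\<lambda>y. f y - (\<Sum>j=1..n. x j * H j y)) (H i) = 0"
    using exists_orthogonal_projection[of "t 1" "t n" n H f p, OF t_1_n continuous_on_H f] by blast
  define g where "g y = (\<Sum>j=1..n. x j * H j y)" for y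
  have cg: "continuous_on {t 1..t n} g"
    unfolding g_def by (intro continuous_on_lincomb continuous_on_H)
  have "projH p t phi n f = g"
    unfolding projH_def
  proof (rule the_equality)
    show "g \<in> Hspace t phi n \<and> (\<forall>h\<in>Hspace t phi n. ipp p (t 1) (t n) (\<lambda>x. f x - g x) h = 0)"
    proof (intro conjI ballI)
      show "g \<in> Hspace t phi n" unfolding Hspace_def g_def by blast
      fix h assume "h \<in> Hspace t phi n"
      then obtain d where h: "h = (\<lambda>y. \<Sum>j=1..n. d j * H j y)" unfolding Hspace_def by blast
      have "ipp p (t 1) (t n) h (\<lambda>x. f x - g x)
          = (\<Sum>j=1..n. d j * ipp p (t 1) (t n) (H j) (\<lambda>x. f x - g x))"
        unfolding h by (intro ipp_sum continuous_on_H continuous_on_diff f cg) auto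
      also have "\<dots> = 0"
        using x by (intro sum.neutral) (simp add: ipp_commute[of p _ _ "H _"] g_def)
      finally show "ipp p (t 1) (t n) (\<lambda>x. f x - g x) h = 0" by (simp add: ipp_commute)
    qed
  next
    fix g' assume g': "g' \<in> Hspace t phi n \<and>
      (\<forall>h\<in>Hspace t phi n. ipp p (t 1) (t n) (\<lambda>x. f x - g' x) h = 0)"
    then obtain z where z: "g' = (\<lambda>y. \<Sum>j=1..n. z j * H j y)" unfolding Hspace_def by blast
    have "(\<Sum>j=1..n. (z j - x j) * s i j) = 0" if i: "i \<in> {1..n}" for i
    proof -
      have "H i = (\<lambda>y. \<Sum>j=1..n. (if j = i then 1 else 0) * H j y)"
        using i by (simp add: if_distrib[of "\<lambda>c. c * _"] sum.delta cong: if_cong)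
      then have "H i \<in> Hspace t phi n"
        unfolding Hspace_def by (intro CollectI exI[of _ "\<lambda>j. if j = i then 1 else 0"] conjI TrueI)
      then have "ipp p (t 1) (t n) (\<lambda>x. f x - g' x) (H i) = 0" using g' by blast
      then show ?thesis
        using lin[OF i, of z] lin[OF i, of x] x[OF i]
        by (simp add: z left_diff_distrib sum_subtractf)
    qed
    then have "\<bar>z k - x k\<bar> \<le> 0 / (1 - c)" if "k \<in> {1..n}" for k
      using that by (intro coefficient_bound[of "\<lambda>j. z j - x j"]) simp_all
    then show "g' = g" unfolding z g_def by (intro ext sum.cong) auto
  qed
  moreover have "(\<Sum>j=1..n. x j * s i j) = ipp p (t 1) (t n) f (H i)" if "i \<in> {1..n}" for i
    using lin[OF that, of x] x[OF that] by simp
  ultimately show ?thesis using that unfolding g_def by blast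
qed

text \<open>As the hats are nonnegative, \<bar>\<langle>f, H_i\<rangle>\<bar> is at most the sup
  norm of f times the weighted integral of H_i, hence at most that norm times
  \<open>M * s i i\<close>. Boundedness of \<open>opratios\<close> is part of the conclusion because
  a real \<open>Sup\<close> is meaningful only for bounded sets.\<close>

lemma opnorm_bound:
  assumes M: "0 \<le> M"
    and rise_M: "\<And>j. 1 \<le> j \<Longrightarrow> j < n \<Longrightarrow> integral {t j..t (Suc j)} (\<lambda>x. rise j x * exp (p * x))
      \<le> M * integral {t j..t (Suc j)} (\<lambda>x. rise j x * rise j x * exp (p * x))"
    and fall_M: "\<And>j. 1 \<le> j \<Longrightarrow> j < n \<Longrightarrow> integral {t j..t (Suc j)} (\<lambda>x. fall j x * exp (p * x))
      \<le> M * integral {t j..t (Suc j)} (\<lambda>x. fall j x * fall j x * exp (p * x))"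
  defines "B \<equiv> (SUP x\<in>{t 1..t n}. \<Sum>j=1..n. \<bar>H j x\<bar>) * M / (1 - c)"
  shows "bdd_above (opratios p t phi n)" "opnormH p t phi n \<le> B"
proof -
  define L where "L = (SUP x\<in>{t 1..t n}. \<Sum>j=1..n. \<bar>H j x\<bar>)"
  have L: "(\<Sum>j=1..n. \<bar>H j x\<bar>) \<le> L" if "x \<in> {t 1..t n}" for x
    unfolding L_def
  proof (rule cSUP_upper[OF that], rule bdd_aboveI2)
    fix x assume x: "x \<in> {t 1..t n}"
    show "(\<Sum>j=1..n. \<bar>H j x\<bar>) \<le> real n"
      using sum_bounded_above[of "{1..n}" "\<lambda>j. \<bar>H j x\<bar>" 1] H_bounds[OF x] by simp
  qed
  have H1: "integral {t 1..t n} (\<lambda>x. H i x * exp (p * x)) \<le> M * s i i" if i: "i \<in> {1..n}" for i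
  proof -
    have "2 \<le> i \<Longrightarrow> integral {t (i - 1)..t i} (\<lambda>x. rise (i - 1) x * exp (p * x))
        \<le> M * integral {t (i - 1)..t i} (\<lambda>x. rise (i - 1) x * rise (i - 1) x * exp (p * x))"
      using rise_M[of "i - 1"] i by auto
    moreover have "integral {t 1..t n} (\<lambda>x. H i x * exp (p * x))
        = (if 2 \<le> i then integral {t (i - 1)..t i} (\<lambda>x. rise (i - 1) x * exp (p * x)) else 0)
        + (if i < n then integral {t i..t (Suc i)} (\<lambda>x. fall i x * exp (p * x)) else 0)"
      using integral_H_split[OF i, of "\<lambda>y. y"] continuous_on_id by simp
    ultimately show ?thesis
      unfolding gram_diag[OF i] using fall_M[of i] i
      by (cases "2 \<le> i"; cases "i < n") (auto simp: distrib_left intro: add_mono)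
  qed
  have ratio: "q \<le> B" if q: "q \<in> opratios p t phi n" for q
  proof -
    from q obtain f where qf: "q = supn (t 1) (t n) (projH p t phi n f) / supn (t 1) (t n) f"
      and f: "continuous_on {t 1..t n} f" and nz: "\<exists>x\<in>{t 1..t n}. f x \<noteq> 0"
      unfolding opratios_def by blast
    define N where "N = supn (t 1) (t n) f"
    have N: "\<bar>f y\<bar> \<le> N" if "y \<in> {t 1..t n}" for y
      unfolding N_def using supn_ge[OF f that] .
    have N0: "N > 0" using nz N by force
    obtain x where x: "projH p t phi n f = (\<lambda>y. \<Sum>j=1..n. x j * H j y)"
      "\<And>i. i \<in> {1..n} \<Longrightarrow> (\<Sum>j=1..n. x j * s i j) = ipp p (t 1) (t n) f (H i)"
      using projH_coefficients[OF f] by blast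
    have rhs: "\<bar>\<Sum>j=1..n. x j * s i j\<bar> \<le> N * M * s i i" if i: "i \<in> {1..n}" for i
    proof -
      have H: "(\<lambda>x. H i x * exp (p * x)) integrable_on {t 1..t n}"
        by (intro integrable_continuous_interval continuous_on_mult continuous_on_exp
            continuous_on_const continuous_on_id continuous_on_H i)
      have "\<bar>ipp p (t 1) (t n) f (H i)\<bar> \<le> integral {t 1..t n} (\<lambda>x. N * (H i x * exp (p * x)))"
        unfolding ipp_def real_norm_def[symmetric]
      proof (rule Henstock_Kurzweil_Integration.integral_norm_bound_integral)
        show "(\<lambda>x. f x * H i x * exp (p * x)) integrable_on {t 1..t n}"
          by (rule ipp_integrable[OF f continuous_on_H[OF i]])
        show "(\<lambda>x. N * (H i x * exp (p * x))) integrable_on {t 1..t n}"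
          using H by (rule integrable_on_mult_right)
        fix y assume y: "y \<in> {t 1..t n}"
        then have "\<bar>f y\<bar> * (H i y * exp (p * y)) \<le> N * (H i y * exp (p * y))"
          using N[OF y] H_bounds[OF y i] by (intro mult_right_mono) auto
        then show "norm (f y * H i y * exp (p * y)) \<le> N * (H i y * exp (p * y))"
          using H_bounds[OF y i] by (simp add: abs_mult mult.assoc)
      qed
      also have "\<dots> \<le> N * (M * s i i)" using H1[OF i] N0 by simp
      finally show ?thesis using x(2)[OF i] by (simp add: mult.assoc)
    qed
    have xk: "\<bar>x k\<bar> \<le> N * M / (1 - c)" if "k \<in> {1..n}" for k
      using coefficient_bound[OF rhs that] .
    have "supn (t 1) (t n) (projH p t phi n f) \<le> N * B"
      unfolding supn_def
    proof (rule cSUP_least)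
      show "{t 1..t n} \<noteq> {}" using t_1_n by simp
      fix y assume y: "y \<in> {t 1..t n}"
      have "\<bar>projH p t phi n f y\<bar> \<le> (\<Sum>j=1..n. \<bar>x j * H j y\<bar>)"
        unfolding x(1) by (rule sum_abs)
      also have "\<dots> \<le> (\<Sum>j=1..n. N * M / (1 - c) * \<bar>H j y\<bar>)"
        by (intro sum_mono) (simp only: abs_mult, intro mult_right_mono xk, auto)
      also have "\<dots> \<le> N * M / (1 - c) * L"
        unfolding sum_distrib_left[symmetric] using L[OF y] M N0 c by (intro mult_left_mono) auto
      also have "\<dots> = N * B" by (simp add: B_def L_def)
      finally show "\<bar>projH p t phi n f y\<bar> \<le> N * B" .
    qed
    then show "q \<le> B" using N0 unfolding qf N_def[symmetric] by (simp add: pos_divide_le_eq mult.commute)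
  qed
  then show "bdd_above (opratios p t phi n)" by (rule bdd_aboveI)
  have "\<exists>x\<in>{t 1..t n}. (1::real) \<noteq> 0" using t_1_n by (intro bexI[of _ "t 1"]) auto
  then have "opratios p t phi n \<noteq> {}"
    unfolding opratios_def using continuous_on_const[of "{t 1..t n}" "1::real"] by blast
  then show "opnormH p t phi n \<le> B"
    unfolding opnormH_def by (rule cSup_least) (rule ratio)
qed

end

section \<open>Exponential splines\<close>

lemma exponential_hat_basis:
  assumes "n \<ge> 2"
    and mono: "\<forall>j\<in>{1..n-1}. strict_mono_on {-\<delta>..\<delta>} (Phi [l0 j, l1 j])"
    and less: "\<forall>j\<in>{1..n-1}. t j < t (j+1)"
    and width: "\<forall>j\<in>{1..n-1}. t (j+1) - t j \<le> \<delta>"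
  shows "hat_basis n t (\<lambda>j. Phi [l0 j, l1 j])"
proof
  fix j assume j: "1 \<le> j" "j < n"
  then have j': "j \<in> {1..n-1}" by auto
  then show "t j < t (Suc j)" using less by auto
  show "strict_mono_on {- (t (Suc j) - t j)..t (Suc j) - t j} (Phi [l0 j, l1 j])"
    using bspec[OF width j'] by (intro monotone_on_subset[OF bspec[OF mono j']]) auto
qed (auto simp: assms(1) continuous_on_Phi2)

text \<open>Boundedness is explicit because a real \<open>SUP\<close> controls the values only of a
  bounded family. For \<open>Sfun\<close> it is a premise of the norm estimate alone: if it fails,
  the informal right-hand side is infinite.\<close>

theorem mainTheorem14:
  fixes \<delta> p :: real and n :: nat
    and l0 l1 :: "nat \<Rightarrow> real" and t :: "nat \<Rightarrow> real"
  assumes "\<delta> > 0" and "n \<ge> 3"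
    and "\<forall>j\<in>{1..n-1}. l0 j \<le> l1 j"
    and "\<forall>j\<in>{1..n-1}. strict_mono_on {-\<delta>..\<delta>} (Phi [l0 j, l1 j])"
    and "bdd_above ((\<lambda>h. Max ((\<lambda>j. \<bar>Tfun p (l0 j) (l1 j) h\<bar>) ` {1..n-1}))
                      ` {h. 0 < \<bar>h\<bar> \<and> \<bar>h\<bar> \<le> \<delta>})"
    and "(SUP h\<in>{h. 0 < \<bar>h\<bar> \<and> \<bar>h\<bar> \<le> \<delta>}.
            Max ((\<lambda>j. \<bar>Tfun p (l0 j) (l1 j) h\<bar>) ` {1..n-1})) < 1"
    and "\<forall>j\<in>{1..n-1}. t j < t (j+1)"
    and "\<forall>j\<in>{1..n-1}. t (j+1) - t j \<le> \<delta>"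
  shows "row_diag_dom n (gram p t (\<lambda>j. Phi [l0 j, l1 j]) n)
           (SUP h\<in>{h. 0 < \<bar>h\<bar> \<and> \<bar>h\<bar> \<le> \<delta>}.
              Max ((\<lambda>j. \<bar>Tfun p (l0 j) (l1 j) h\<bar>) ` {1..n-1}))
       \<and> (bdd_above ((\<lambda>h. Max ((\<lambda>j. \<bar>Sfun p (l0 j) (l1 j) h\<bar>) ` {1..n-1}))
                      ` {h. 0 < \<bar>h\<bar> \<and> \<bar>h\<bar> \<le> \<delta>})
          \<longrightarrow> bdd_above (opratios p t (\<lambda>j. Phi [l0 j, l1 j]) n)
            \<and> opnormH p t (\<lambda>j. Phi [l0 j, l1 j]) n
              \<le> (SUP x\<in>{t 1..t n}. \<Sum>j=1..n. \<bar>hat t (\<lambda>j. Phi [l0 j, l1 j]) n j x\<bar>)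
                 * (SUP h\<in>{h. 0 < \<bar>h\<bar> \<and> \<bar>h\<bar> \<le> \<delta>}.
                      Max ((\<lambda>j. \<bar>Sfun p (l0 j) (l1 j) h\<bar>) ` {1..n-1}))
                 / (1 - (SUP h\<in>{h. 0 < \<bar>h\<bar> \<and> \<bar>h\<bar> \<le> \<delta>}.
                      Max ((\<lambda>j. \<bar>Tfun p (l0 j) (l1 j) h\<bar>) ` {1..n-1}))))"
proof -
  let ?D = "{h::real. 0 < \<bar>h\<bar> \<and> \<bar>h\<bar> \<le> \<delta>}"
  let ?phi = "\<lambda>j. Phi [l0 j, l1 j]"
  let ?sup = "\<lambda>F::real \<Rightarrow> real \<Rightarrow> real \<Rightarrow> real \<Rightarrow> real. SUP h\<in>?D. Max ((\<lambda>j. \<bar>F p (l0 j) (l1 j) h\<bar>) ` {1..n-1})"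
  have sup_ge: "\<bar>F p (l0 j) (l1 j) h\<bar> \<le> ?sup F"
    if "bdd_above ((\<lambda>h. Max ((\<lambda>j. \<bar>F p (l0 j) (l1 j) h\<bar>) ` {1..n-1})) ` ?D)"
      and "j \<in> {1..n-1}" "h \<in> ?D" for F :: "real \<Rightarrow> real \<Rightarrow> real \<Rightarrow> real \<Rightarrow> real" and j h
    using that(1,3) by (rule cSUP_upper2) (use that(2) in \<open>auto intro: Max_ge\<close>)
  define c where "c = ?sup Tfun"
  have c: "\<bar>Tfun p (l0 j) (l1 j) h\<bar> \<le> c" if "j \<in> {1..n-1}" "h \<in> ?D" for j h
    unfolding c_def using assms(5) that by (rule sup_ge)
  \<comment> \<open>One admissible index and increment suffice to see that each supremum dominates
    an absolute value and is therefore nonnegative.\<close>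
  have first: "1 \<in> {1..n-1}" "\<delta> \<in> ?D" using assms(1,2) by auto
  interpret hat_basis n t ?phi
    using assms(2,4,7,8) by (intro exponential_hat_basis) auto
  have edge: "j \<in> {1..n-1}" "t (Suc j) - t j \<in> ?D" "t j - t (Suc j) \<in> ?D"
    "?phi j (t (Suc j) - t j) \<noteq> 0" "?phi j (t j - t (Suc j)) \<noteq> 0"
    if j: "1 \<le> j" "j < n" for j
  proof -
    show j': "j \<in> {1..n-1}" using j by auto
    show "t (Suc j) - t j \<in> ?D" "t j - t (Suc j) \<in> ?D"
      using step[OF j] bspec[OF assms(8) j'] by auto
    show "?phi j (t (Suc j) - t j) \<noteq> 0" "?phi j (t j - t (Suc j)) \<noteq> 0"
      using phi_pos[OF j, of "t (Suc j) - t j"] phi_neg[OF j, of "t j - t (Suc j)"] step[OF j] by auto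
  qed
  have rise: "0 < integral {t j..t (Suc j)} (\<lambda>x. rise j x * rise j x * exp (p * x))"
    "integral {t j..t (Suc j)} (\<lambda>x. rise j x * fall j x * exp (p * x))
      = Tfun p (l0 j) (l1 j) (t (Suc j) - t j) *
        integral {t j..t (Suc j)} (\<lambda>x. rise j x * rise j x * exp (p * x))"
    "integral {t j..t (Suc j)} (\<lambda>x. rise j x * exp (p * x))
      = Sfun p (l0 j) (l1 j) (t (Suc j) - t j) *
        integral {t j..t (Suc j)} (\<lambda>x. rise j x * rise j x * exp (p * x))"
    if j: "1 \<le> j" "j < n" for j
    using edge_integrals[of "t (Suc j) - t j" "l0 j" "l1 j" "t j" p] edge(4)[OF j] step[OF j]
    by (simp_all add: rise_def fall_def)
  \<comment> \<open>The same edge read from its right node with negative increment: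
    \<open>fall j\<close> becomes the function that is 1 at the far end. This is why the suprema
    range over both signs of \<open>h\<close>.\<close>
  have fall: "0 < integral {t j..t (Suc j)} (\<lambda>x. fall j x * fall j x * exp (p * x))"
    "integral {t j..t (Suc j)} (\<lambda>x. rise j x * fall j x * exp (p * x))
      = Tfun p (l0 j) (l1 j) (t j - t (Suc j)) *
        integral {t j..t (Suc j)} (\<lambda>x. fall j x * fall j x * exp (p * x))"
    "integral {t j..t (Suc j)} (\<lambda>x. fall j x * exp (p * x))
      = Sfun p (l0 j) (l1 j) (t j - t (Suc j)) *
        integral {t j..t (Suc j)} (\<lambda>x. fall j x * fall j x * exp (p * x))"
    if j: "1 \<le> j" "j < n" for j
  proof -
    have "rise j x * fall j x = fall j x * rise j x" for x by simp
    then show "0 < integral {t j..t (Suc j)} (\<lambda>x. fall j x * fall j x * exp (p * x))"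
      "integral {t j..t (Suc j)} (\<lambda>x. rise j x * fall j x * exp (p * x))
        = Tfun p (l0 j) (l1 j) (t j - t (Suc j)) *
          integral {t j..t (Suc j)} (\<lambda>x. fall j x * fall j x * exp (p * x))"
      "integral {t j..t (Suc j)} (\<lambda>x. fall j x * exp (p * x))
        = Sfun p (l0 j) (l1 j) (t j - t (Suc j)) *
          integral {t j..t (Suc j)} (\<lambda>x. fall j x * fall j x * exp (p * x))"
      using edge_integrals[of "t j - t (Suc j)" "l0 j" "l1 j" "t (Suc j)" p] edge(5)[OF j] step[OF j]
      by (simp_all add: rise_def fall_def mult.commute mult.left_commute)
  qed
  interpret hat_gram n t ?phi p c
  proof
    show "0 \<le> c" using c[OF first] by linarith
    show "c < 1" using assms(6) by (simp add: c_def)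
    fix j assume j: "1 \<le> j" "j < n"
    show "0 < integral {t j..t (Suc j)} (\<lambda>x. rise j x * rise j x * exp (p * x))"
      "0 < integral {t j..t (Suc j)} (\<lambda>x. fall j x * fall j x * exp (p * x))"
      by (fact rise(1)[OF j] fall(1)[OF j])+
    show "\<bar>integral {t j..t (Suc j)} (\<lambda>x. rise j x * fall j x * exp (p * x))\<bar>
        \<le> c * integral {t j..t (Suc j)} (\<lambda>x. rise j x * rise j x * exp (p * x))"
      using c[OF edge(1,2)[OF j]] rise(1)[OF j]
      unfolding rise(2)[OF j] by (simp add: abs_mult)
    show "\<bar>integral {t j..t (Suc j)} (\<lambda>x. rise j x * fall j x * exp (p * x))\<bar>
        \<le> c * integral {t j..t (Suc j)} (\<lambda>x. fall j x * fall j x * exp (p * x))"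
      using c[OF edge(1,3)[OF j]] fall(1)[OF j]
      unfolding fall(2)[OF j] by (simp add: abs_mult)
  qed
  show ?thesis
    unfolding c_def[symmetric]
  proof (intro conjI impI)
    show "row_diag_dom n (gram p t ?phi n) c" by (rule gram_row_diag_dom)
    assume bdd: "bdd_above ((\<lambda>h. Max ((\<lambda>j. \<bar>Sfun p (l0 j) (l1 j) h\<bar>) ` {1..n-1})) ` ?D)"
    define M where "M = ?sup Sfun"
    have M: "\<bar>Sfun p (l0 j) (l1 j) h\<bar> \<le> M" if "j \<in> {1..n-1}" "h \<in> ?D" for j h
      unfolding M_def using bdd that by (rule sup_ge)
    have M0: "0 \<le> M" using M[OF first] by linarith
    have rise_M: "integral {t j..t (Suc j)} (\<lambda>x. rise j x * exp (p * x))
        \<le> M * integral {t j..t (Suc j)} (\<lambda>x. rise j x * rise j x * exp (p * x))"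
      if j: "1 \<le> j" "j < n" for j
      unfolding rise(3)[OF j] using rise(1)[OF j] M[OF edge(1,2)[OF j]] by simp
    have fall_M: "integral {t j..t (Suc j)} (\<lambda>x. fall j x * exp (p * x))
        \<le> M * integral {t j..t (Suc j)} (\<lambda>x. fall j x * fall j x * exp (p * x))"
      if j: "1 \<le> j" "j < n" for j
      unfolding fall(3)[OF j] using fall(1)[OF j] M[OF edge(1,3)[OF j]] by simp
    show "bdd_above (opratios p t ?phi n)"
      by (rule opnorm_bound(1)[OF M0 rise_M fall_M])
    show "opnormH p t ?phi n \<le> (SUP x\<in>{t 1..t n}. \<Sum>j=1..n. \<bar>hat t ?phi n j x\<bar>) * ?sup Sfun / (1 - c)"
      using opnorm_bound(2)[OF M0 rise_M fall_M] unfolding M_def .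
  qed
qed

end
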